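(* For $\alpha>0$ and $\gamma\ge 1$ consider the system $$\dot\theta=-\frac{\alpha\gamma^{1/2}W}{\big((\gamma^{1/2}-1)^2e^{2\theta}+W^2\big)^{3/2}},\qquad \dot W=-\Big(\gamma+\frac1{\gamma^{1/2}}\Big)e^{-\theta}+\frac{\alpha\gamma^{1/2}(\gamma^{1/2}-1)^2e^{2\theta}}{\big((\gamma^{1/2}-1)^2e^{2\theta}+W^2\big)^{3/2}}\qquad (S)$$ with initial data $(\theta(0),W(0))=(\theta_0,W_0)$, and let $$\mathcal H(\theta,W)=-\Big(\gamma+\frac1{\gamma^{1/2}}\Big)e^{-\theta}+\frac{\alpha\gamma^{1/2}}{\big((\gamma^{1/2}-1)^2e^{2\theta}+W^2\big)^{1/2}} .$$ For any $\alpha\in(0,1)$, there exists a unique $\gamma_*\in(1,\infty)$ such that the following four statements hold. (i) When $\gamma=1$, the phase space is $\mathbf R^2\setminus(\mathbf R\times\{0\})$ and the following two statements are equivalent: (a) the solution of (S) with initial data $(\theta_0,W_0)\in\mathbf R^2\setminus(\mathbf R\times\{0\})$ is a solution corresponding to head-on collision; (b) $W_0>0$. (ii) When $\gamma\in(1,\gamma_* )$, the phase space is $\mathbf R^2$ and there exists $\theta_*\in\mathbf R$ such that the following two statements are equivalent: (a) the solution of (S) with initial data $(\theta_0,W_0)\in\mathbf R^2$ corresponds to asymmetric collision; (b) $W_0>0$ and one of the following holds: (c) $\mathcal H(\theta_0,W_0)\le 0$; (d) $\mathcal H(\theta_0,W_0)>0$ and $\theta_0\le\theta_*$. (iii) When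 $\gamma=\gamma_*$, the phase space is $\mathbf R^2$ and the following two statements are equivalent: (a) the solution of (S) with initial data $(\theta_0,W_0)\in\mathbf R^2$ corresponds to asymmetric collision; (b) $W_0>0$. (iv) When $\gamma\in(\gamma_*,\infty)$, the phase space is $\mathbf R^2$. In this case, none of the solutions correspond to asymmetric collision, and every solution $(\theta,W)$ of (S) with initial data $(\theta_0,W_0)\in\mathbf R^2$ has the following properties: (a) $(\theta,W)\in C^1((0,\infty))\times C^1((0,\infty))$; (b) $W$ is monotonically decreasing and $W(t)\to-\infty$ as $t\to\infty$.
   Context: A dot denotes $d/dt$. The phase space of (S) is the set of $(\theta,W)\in\mathbf R^2$ on which the right-hand side of (S) (equivalently $\mathcal H$) is defined, i.e. where the denominators do not vanish; solutions take values in the phase space. $T_{max}$ denotes the maximum existence time (forward in time) of the solution under consideration; the solution is called a finite-time solution if $T_{max}<\infty$. Definitions. For $\gamma=1$: a finite-time solution $(\theta,W)\in C^1([0,T_{max}))\times C^1([0,T_{max}))$ of (S) with initial data $(\theta_0,W_0)$ satisfying $W_0\ne 0$ is called a solution corresponding to head-on collision if $W(t)\to0$ monotonically as $t\to T_{max}$. For $\gamma>1$: a finite-time solution $(\theta,W)\in C^1([0,T_{max}))\times C^1([0,T_{max}))$ of (S) with initial data $(\theta_0,W_0)$ satisfying $W_0\neq0$ is called a solution corresponding to asymmetric collision if $W(t)\to 0$ monotonically as $t\to T_{max}$. (Origin of the system: $\theta=\log R_1$ and $W=z_1-z_2$, where $R_1$ and $R_2=\gamma^{1/2}R_1$ are the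 radii and $z_1,z_2$ the axial positions of two coaxial circular vortex filaments with circulations of opposite sign and ratio of absolute values $\gamma$.)
   Formalization: In (ii), θ_* is a function of the energy H(θ_0,W_0) (for fixed α, γ) rather than one real number; a single θ_* is impossible because (S) is invariant under (θ,W,t)→(θ+s, e^s W, e^{2s} t), which shifts θ_0 arbitrarily while preserving collision and the sign of H. *)

theory Defs
  imports "HOL-Analysis.Analysis"
begin

definition dsq :: "real \<Rightarrow> real \<Rightarrow> real \<Rightarrow> real" where
  "dsq \<gamma> \<theta> W = (sqrt \<gamma> - 1)\<^sup>2 * exp (2 * \<theta>) + W\<^sup>2"

definition rhs_theta :: "real \<Rightarrow> real \<Rightarrow> real \<Rightarrow> real \<Rightarrow> real" where
  "rhs_theta \<alpha> \<gamma> \<theta> W = - (\<alpha> * sqrt \<gamma> * W) / dsq \<gamma> \<theta> W powr (3/2)"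

definition rhs_W :: "real \<Rightarrow> real \<Rightarrow> real \<Rightarrow> real \<Rightarrow> real" where
  "rhs_W \<alpha> \<gamma> \<theta> W =
     - (\<gamma> + 1 / sqrt \<gamma>) * exp (- \<theta>)
     + \<alpha> * sqrt \<gamma> * (sqrt \<gamma> - 1)\<^sup>2 * exp (2 * \<theta>) / dsq \<gamma> \<theta> W powr (3/2)"

(* The system is Hamiltonian for this function, so it is constant along solutions.
   The system is also invariant under (\<theta>, W, t) \<mapsto> (\<theta> + s, e^s W, e^(2 s) t), which
   multiplies the Hamiltonian by e^(-s). A threshold value of \<theta> separating two kinds of
   orbits with positive Hamiltonian can therefore only be attached to an energy level. *)
definition hamiltonian :: "real \<Rightarrow> real \<Rightarrow> real \<Rightarrow> real \<Rightarrow> real" where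
  "hamiltonian \<alpha> \<gamma> \<theta> W =
     - (\<gamma> + 1 / sqrt \<gamma>) * exp (- \<theta>) + \<alpha> * sqrt \<gamma> / dsq \<gamma> \<theta> W powr (1/2)"

definition phase_space :: "real \<Rightarrow> (real \<times> real) set" where
  "phase_space \<gamma> = {(\<theta>, W). dsq \<gamma> \<theta> W powr (3/2) \<noteq> 0 \<and> dsq \<gamma> \<theta> W powr (1/2) \<noteq> 0}"

(* Derivatives are taken within S, hence one-sided at the endpoint 0 of {0..<T};
   C1_differentiable_on from the library would ask for a two-sided derivative there. *)
definition C1_on :: "real set \<Rightarrow> (real \<Rightarrow> real) \<Rightarrow> bool" where
  "C1_on S f \<longleftrightarrow>
     (\<exists>f'. continuous_on S f' \<and> (\<forall>t\<in>S. (f has_real_derivative f' t) (at t within S)))"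

definition times :: "ereal \<Rightarrow> real set" where
  "times T = {t. 0 \<le> t \<and> ereal t < T}"

definition is_solution ::
  "real \<Rightarrow> real \<Rightarrow> real \<Rightarrow> real \<Rightarrow> ereal \<Rightarrow> (real \<Rightarrow> real) \<Rightarrow> (real \<Rightarrow> real) \<Rightarrow> bool" where
  "is_solution \<alpha> \<gamma> \<theta>0 W0 T \<theta> W \<longleftrightarrow>
     0 < T \<and> \<theta> 0 = \<theta>0 \<and> W 0 = W0 \<and>
     C1_on (times T) \<theta> \<and> C1_on (times T) W \<and>
     (\<forall>t\<in>times T.
        (\<theta> t, W t) \<in> phase_space \<gamma> \<and>
        (\<theta> has_real_derivative rhs_theta \<alpha> \<gamma> (\<theta> t) (W t)) (at t within times T) \<and>
        (W has_real_derivative rhs_W \<alpha> \<gamma> (\<theta> t) (W t)) (at t within times T))"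

(* T is the maximum existence time (possibly \<infinity>): the solution on [0, T) has no extension to
   a solution on a longer interval. Values of \<theta> and W outside [0, T) are irrelevant. *)
definition is_max_solution ::
  "real \<Rightarrow> real \<Rightarrow> real \<Rightarrow> real \<Rightarrow> ereal \<Rightarrow> (real \<Rightarrow> real) \<Rightarrow> (real \<Rightarrow> real) \<Rightarrow> bool" where
  "is_max_solution \<alpha> \<gamma> \<theta>0 W0 T \<theta> W \<longleftrightarrow>
     is_solution \<alpha> \<gamma> \<theta>0 W0 T \<theta> W \<and>
     \<not> (\<exists>T' \<theta>' W'. T < T' \<and> is_solution \<alpha> \<gamma> \<theta>0 W0 T' \<theta>' W' \<and>
           (\<forall>t\<in>times T. \<theta>' t = \<theta> t \<and> W' t = W t))"

(* Monotonicity of W is required on the whole of [0, Tmax), not only near Tmax. *)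
definition is_collision_solution ::
  "real \<Rightarrow> real \<Rightarrow> real \<Rightarrow> real \<Rightarrow> real \<Rightarrow> (real \<Rightarrow> real) \<Rightarrow> (real \<Rightarrow> real) \<Rightarrow> bool" where
  "is_collision_solution \<alpha> \<gamma> \<theta>0 W0 Tmax \<theta> W \<longleftrightarrow>
     is_max_solution \<alpha> \<gamma> \<theta>0 W0 (ereal Tmax) \<theta> W \<and> W0 \<noteq> 0 \<and>
     (mono_on {0..<Tmax} W \<or> antimono_on {0..<Tmax} W) \<and>
     (W \<longlongrightarrow> 0) (at_left Tmax)"

definition head_on_collision :: "real \<Rightarrow> real \<Rightarrow> real \<Rightarrow> bool" where
  "head_on_collision \<alpha> \<theta>0 W0 \<longleftrightarrow>
     (\<exists>Tmax \<theta> W. is_collision_solution \<alpha> 1 \<theta>0 W0 Tmax \<theta> W)"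

definition asymmetric_collision :: "real \<Rightarrow> real \<Rightarrow> real \<Rightarrow> real \<Rightarrow> bool" where
  "asymmetric_collision \<alpha> \<gamma> \<theta>0 W0 \<longleftrightarrow>
     \<gamma> > 1 \<and> (\<exists>Tmax \<theta> W. is_collision_solution \<alpha> \<gamma> \<theta>0 W0 Tmax \<theta> W)"

end

theory Submission
  imports Defs
begin

text \<open>Put \<open>w = W e\<^sup>-\<^sup>\<theta>\<close>, the scale-invariant variable. Then \<open>H = e\<^sup>-\<^sup>\<theta> h(w)\<close> for an explicit \<open>h\<close>,
  and \<open>w' = H e\<^sup>-\<^sup>\<theta>\<close>, so that \<open>h(w) w' = H\<^sup>2\<close>: for a primitive \<open>G\<close> of \<open>h\<close>, the function \<open>G(w(t))\<close>
  is affine in \<open>t\<close>. Inverting \<open>G\<close> where \<open>h\<close> has constant sign solves the system explicitly, by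
  \<open>e\<^sup>\<theta> = h(w)/H\<close>, and gives uniqueness and extension of solutions without any general theory.
  If \<open>h\<close> has a zero \<open>w\<^sub>s \<ge> 0\<close>, orbits with \<open>W > 0\<close> reach it in finite time, and there
  \<open>e\<^sup>\<theta> = h(w)/H\<close> and \<open>W\<close> vanish; monotonicity of \<open>W\<close> is decided by the sign of \<open>W'\<close> at time \<open>0\<close>.
  If \<open>h < 0\<close> everywhere, solutions are global. The critical \<open>\<gamma>\<close> is the one with \<open>h(0) = 0\<close>. At \<open>H = 0\<close>
  the variable \<open>w\<close> is constant and \<open>e\<^sup>2\<^sup>\<theta>\<close> is affine in \<open>t\<close>.\<close>

text \<open>Solves \<open>w' = q / h w\<close> by inverting a primitive \<open>G\<close> of \<open>h\<close>. The end point \<open>w1\<close> need not lie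
  in \<open>S\<close>: it may be a zero of \<open>h\<close>.\<close>
lemma inverse_flow:
  fixes G h :: "real \<Rightarrow> real"
  assumes "open S" and seg: "closed_segment w0 w1 - {w1} \<subseteq> S"
    and inj: "inj_on G (insert w1 S)"
    and der: "\<And>w. w \<in> insert w1 S \<Longrightarrow> (G has_real_derivative h w) (at w)"
    and nz: "\<And>w. w \<in> S \<Longrightarrow> h w \<noteq> 0"
    and q: "0 < q" and T: "0 < T" and Gw1: "G w1 = G w0 + q * T"
  obtains w where "w 0 = w0" "w T = w1" "continuous_on {0..T} w"
    "\<And>t. t \<in> {0..<T} \<Longrightarrow> w t \<in> closed_segment w0 w1 - {w1}"
    "\<And>t. t \<in> {0..<T} \<Longrightarrow> (w has_real_derivative q / h (w t)) (at t)"
proof -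
  \<comment> \<open>The inverse is taken on \<open>insert w1 S\<close>, so that it also returns
    \<open>w1\<close> at time \<open>T\<close>.\<close>
  define g where "g = the_inv_into (insert w1 S) G"
  define w where "w t = g (G w0 + q * t)" for t
  let ?J = "closed_segment w0 w1"
  have J: "?J \<subseteq> insert w1 S" using seg by auto
  have gG: "g (G x) = x" if "x \<in> insert w1 S" for x
    using the_inv_into_f_f[OF inj that] by (simp add: g_def)
  have contG: "continuous_on (insert w1 S) G"
    using der by (meson DERIV_isCont continuous_at_imp_continuous_on)
  have contJ: "continuous_on ?J G"
    using contG J continuous_on_subset by blast
  \<comment> \<open>Intermediate values: the image of the segment is connected and contains both
    \<open>G w0\<close> and \<open>G w1\<close>.\<close>
  have surj: "\<exists>x\<in>?J. G x = G w0 + q * t" if "t \<in> {0..T}" for t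
  proof -
    have "connected (G ` ?J)"
      using contJ connected_continuous_image connected_segment(1) by blast
    moreover have "G w0 \<in> G ` ?J" "G w1 \<in> G ` ?J" by auto
    moreover have "G w0 \<le> G w0 + q * t" "G w0 + q * t \<le> G w1"
      using that q Gw1 by (auto intro: mult_left_mono)
    ultimately have "G w0 + q * t \<in> G ` ?J" by (rule connectedD_interval)
    then show ?thesis by (metis (no_types, lifting) imageE)
  qed
  have wJ: "w t \<in> ?J \<and> G (w t) = G w0 + q * t" if "t \<in> {0..T}" for t
    using surj[OF that] gG J unfolding w_def by (metis subsetD)
  have w0: "w 0 = w0" using gG[of w0] J by (auto simp: w_def)
  have wT: "w T = w1" using gG[of w1] by (simp add: w_def flip: Gw1)
  have cont: "continuous_on {0..T} w"
  proof -
    have cg: "continuous_on (G ` ?J) g"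
      using contJ compact_segment J gG by (intro continuous_on_inv) auto
    have sub: "(\<lambda>t. G w0 + q * t) ` {0..T} \<subseteq> G ` ?J"
      using surj by (smt (verit) imageE imageI subsetI)
    have "continuous_on {0..T} (\<lambda>t. G w0 + q * t)" by (intro continuous_intros)
    then show ?thesis unfolding w_def[abs_def]
      by (rule continuous_on_compose2[OF cg _ sub])
  qed
  have wseg: "w t \<in> ?J - {w1}" if "t \<in> {0..<T}" for t
  proof -
    have "G (w t) = G w0 + q * t" "w t \<in> ?J" using wJ[of t] that by auto
    moreover have "G w0 + q * t \<noteq> G w1" using Gw1 q that by auto
    ultimately show ?thesis by auto
  qed
  have wder: "(w has_real_derivative q / h (w t)) (at t)" if t: "t \<in> {0..<T}" for t
  proof -
    have x: "w t \<in> S" "G (w t) = G w0 + q * t" using wseg[OF t] seg wJ[of t] t by auto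
    \<comment> \<open>Differentiating the inverse takes an open set around the point and a nonzero
      \<open>h\<close>, which is guaranteed only before time \<open>T\<close>.\<close>
    have "(g has_derivative (*) (inverse (h (w t)))) (at (G (w t)))"
    proof (rule has_derivative_inverse_strong[OF \<open>open S\<close> x(1)])
      show "(G has_derivative (*) (h (w t))) (at (w t))"
        using der x(1) by (simp add: has_field_derivative_def)
      show "(*) (h (w t)) \<circ> (*) (inverse (h (w t))) = id"
        using nz x(1) by auto
      show "continuous_on S G" using contG continuous_on_subset by blast
      show "g (G z) = z" if "z \<in> S" for z using gG that by simp
    qed
    then have g: "(g has_real_derivative inverse (h (w t))) (at (G w0 + q * t))"
      by (simp add: x has_field_derivative_def)
    have "((\<lambda>t. G w0 + q * t) has_real_derivative q) (at t)"
      by (auto intro!: derivative_eq_intros)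
    from DERIV_chain2[where f = g and g = "\<lambda>t. G w0 + q * t", OF g this]
    have "(w has_real_derivative inverse (h (w t)) * q) (at t)" by (simp only: w_def[abs_def])
    then show ?thesis by (simp add: divide_inverse mult.commute)
  qed
  show thesis using that[OF w0 wT cont wseg wder] .
qed

section \<open>Time intervals of solutions\<close>

lemma times_0: "0 < T \<Longrightarrow> 0 \<in> times T"
  by (auto simp: times_def zero_ereal_def)

lemma times_ereal [simp]: "times (ereal T) = {0..<T}"
  by (auto simp: times_def)

lemma times_infinity [simp]: "times \<infinity> = {0..}"
  by (auto simp: times_def)

text \<open>Serves to conclude that a function with vanishing derivative within the interval is
  constant.\<close>

lemma convex_times: "convex (times T)"
  by (cases T) (auto simp: times_def convex_contains_segment
      closed_segment_eq_real_ivl split: if_splits)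

section \<open>The scaled system\<close>

locale vortex =
  fixes \<alpha> \<gamma> :: real
  assumes alpha_pos: "0 < \<alpha>" and gamma_ge: "1 \<le> \<gamma>"
begin

definition k where "k = sqrt \<gamma> - 1"
definition c where "c = \<gamma> + 1 / sqrt \<gamma>"
definition b where "b = \<alpha> * sqrt \<gamma>"

text \<open>Distance of the two filaments in a meridian half-plane, in units of
  \<open>exp \<theta>\<close>.\<close>

definition sep :: "real \<Rightarrow> real" where "sep w = sqrt (k\<^sup>2 + w\<^sup>2)"

text \<open>The Hamiltonian is \<open>e\<^sup>-\<^sup>\<theta> h w\<close> and the right-hand side of the equation for \<open>W\<close> is
  \<open>e\<^sup>-\<^sup>\<theta> f w\<close>, where \<open>w = W e\<^sup>-\<^sup>\<theta>\<close>.\<close>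
definition h :: "real \<Rightarrow> real" where "h w = - c + b / sep w"
definition f :: "real \<Rightarrow> real" where "f w = - c + b * k\<^sup>2 / sep w ^ 3"
text \<open>A primitive of \<open>h\<close>. For \<open>0 < k\<close> the logarithm is the inverse
  hyperbolic sine of \<open>w / k\<close> up to a constant; this form also serves
  \<open>k = 0\<close> when \<open>0 < w\<close>.\<close>

definition G :: "real \<Rightarrow> real" where "G w = - c * w + b * ln (w + sep w)"

section \<open>Signs, derivatives and comparison of the scaled functions\<close>

lemma k_nonneg: "0 \<le> k" using gamma_ge by (simp add: k_def)
lemma c_pos: "0 < c" using gamma_ge by (simp add: c_def add_pos_nonneg)
lemma b_pos: "0 < b" using gamma_ge alpha_pos by (simp add: b_def)

lemma sep_nonneg: "0 \<le> sep w" by (simp add: sep_def)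

lemma sep_pos_iff: "0 < sep w \<longleftrightarrow> 0 < k \<or> w \<noteq> 0"
  using k_nonneg by (auto simp: sep_def add_pos_nonneg add_nonneg_pos)

lemma sep_power2: "(sep w)\<^sup>2 = k\<^sup>2 + w\<^sup>2" by (simp add: sep_def)

lemma k_le_sep: "k \<le> sep w"
  unfolding sep_def by (rule real_le_rsqrt) simp

text \<open>Keeps the argument of the logarithm in \<open>G\<close> positive. For
  \<open>k = 0\<close> and \<open>w \<le> 0\<close> the sum is \<open>0\<close>, whence the
  recurring condition \<open>0 < k \<or> 0 < w\<close>.\<close>

lemma add_sep_pos: "0 < w + sep w" if "0 < k \<or> 0 < w"
proof (cases "0 < w")
  case False
  then have "0 < k" using that by simp
  then have "w\<^sup>2 < k\<^sup>2 + w\<^sup>2" by simp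
  then have "\<bar>w\<bar> < sep w" unfolding sep_def
    by (metis real_sqrt_abs real_sqrt_less_iff)
  then show ?thesis by linarith
qed (simp add: add_pos_nonneg sep_nonneg)

lemma sep_deriv:
  assumes "0 < sep w"
  shows "(sep has_real_derivative w / sep w) (at w)"
proof -
  have "0 < k\<^sup>2 + w\<^sup>2" using assms by (simp add: sep_def)
  then show ?thesis unfolding sep_def[abs_def]
    by (auto intro!: derivative_eq_intros simp: field_simps)
qed

lemma h_deriv:
  assumes "0 < sep w"
  shows "(h has_real_derivative - (b * w / sep w ^ 3)) (at w)"
  unfolding h_def[abs_def]
  by (rule DERIV_cong[OF DERIV_add[OF DERIV_const DERIV_divide[OF DERIV_const sep_deriv]]])
    (use assms in \<open>auto simp: power3_eq_cube\<close>)

lemma G_deriv: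
  assumes "0 < k \<or> 0 < w"
  shows "(G has_real_derivative h w) (at w)"
proof -
  have p: "0 < w + sep w" "0 < sep w" using add_sep_pos[OF assms] assms sep_pos_iff by auto
  have e: "inverse (w + sep w) * (1 + w / sep w) = 1 / sep w"
    using p by (simp add: divide_simps)
  have "((\<lambda>w. ln (w + sep w)) has_real_derivative inverse (w + sep w) * (1 + w / sep w)) (at w)"
    by (rule DERIV_chain2[where f = ln and g = "\<lambda>w. w + sep w", OF DERIV_ln[OF p(1)]])
      (auto intro!: derivative_eq_intros sep_deriv p)
  from DERIV_add[OF DERIV_cmult[OF DERIV_ident, of "- c"] DERIV_cmult[OF this, of b]]
  show ?thesis
    unfolding G_def[abs_def] h_def e by simp
qed

lemma f_le_h:
  assumes "0 < sep w"
  shows "f w \<le> h w"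
proof -
  have "k\<^sup>2 \<le> (sep w)\<^sup>2" by (simp add: sep_power2)
  then have "b * k\<^sup>2 / sep w ^ 3 \<le> b * (sep w)\<^sup>2 / sep w ^ 3"
    using assms b_pos by (intro divide_right_mono mult_left_mono) auto
  also have "\<dots> = b / sep w"
    using assms by (simp add: power2_eq_square power3_eq_cube)
  finally show ?thesis by (simp add: f_def h_def)
qed

text \<open>Off \<open>w = 0\<close> a nonpositive energy therefore makes \<open>W\<close> strictly
  decreasing, and a nonnegative \<open>f\<close> forces positive energy.\<close>

lemma f_less_h:
  assumes "w \<noteq> 0"
  shows "f w < h w"
proof -
  have s: "0 < sep w" using assms sep_pos_iff by simp
  have "k\<^sup>2 < (sep w)\<^sup>2" using assms by (simp add: sep_power2)
  then have "b * k\<^sup>2 / sep w ^ 3 < b * (sep w)\<^sup>2 / sep w ^ 3"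
    using s b_pos by (intro divide_strict_right_mono mult_strict_left_mono) auto
  also have "\<dots> = b / sep w"
    using s by (simp add: power2_eq_square power3_eq_cube)
  finally show ?thesis by (simp add: f_def h_def)
qed

lemma f_antimono:
  assumes "0 < sep x" "sep x \<le> sep y"
  shows "f y \<le> f x"
proof -
  have "sep x ^ 3 \<le> sep y ^ 3" using assms by (intro power_mono) auto
  then have "b * k\<^sup>2 / sep y ^ 3 \<le> b * k\<^sup>2 / sep x ^ 3"
    using assms b_pos by (intro divide_left_mono mult_pos_pos zero_less_power) auto
  then show ?thesis by (simp add: f_def)
qed

section \<open>The original system in terms of the scaled variable\<close>

lemma dsq_eq: "dsq \<gamma> \<theta> W = (exp \<theta> * sep (W * exp (- \<theta>)))\<^sup>2"
proof -
  have "exp (2 * \<theta>) = (exp \<theta>)\<^sup>2" by (rule exp_double)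
  then show ?thesis
    unfolding dsq_def k_def[symmetric]
    by (simp only: power_mult_distrib sep_power2) (simp add: exp_minus field_simps)
qed

lemma dsq_powr_half: "dsq \<gamma> \<theta> W powr (1/2) = exp \<theta> * sep (W * exp (- \<theta>))"
  unfolding dsq_eq by (simp add: powr_half_sqrt sep_nonneg)

lemma dsq_powr_three_halves:
  "dsq \<gamma> \<theta> W powr (3/2) = (exp \<theta> * sep (W * exp (- \<theta>))) ^ 3"
\<comment> \<open>At zero separation both sides vanish, since \<open>0 powr (3/2)\<close> is
  \<open>0\<close>.\<close>
proof (cases "sep (W * exp (- \<theta>)) = 0")
  case False
  define x where "x = exp \<theta> * sep (W * exp (- \<theta>))"
  have "0 < x" using False sep_nonneg[of "W * exp (- \<theta>)"] by (simp add: x_def)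
  then have "x\<^sup>2 powr (3/2) = x ^ 3"
    by (simp add: powr_powr flip: powr_numeral)
  then show ?thesis by (simp add: dsq_eq x_def)
qed (simp add: dsq_eq)

lemma in_phase_space: "(\<theta>, W) \<in> phase_space \<gamma> \<longleftrightarrow> 0 < sep (W * exp (- \<theta>))"
  using sep_nonneg[of "W * exp (- \<theta>)"]
  by (simp add: phase_space_def dsq_powr_half dsq_powr_three_halves order_less_le)

lemma hamiltonian_eq: "hamiltonian \<alpha> \<gamma> \<theta> W = exp (- \<theta>) * h (W * exp (- \<theta>))"
  by (simp add: hamiltonian_def dsq_powr_half h_def b_def c_def exp_minus field_simps)

text \<open>At nonzero energy this recovers \<theta> from the scaled variable.\<close>

lemma h_eq: "h (W * exp (- \<theta>)) = hamiltonian \<alpha> \<gamma> \<theta> W * exp \<theta>"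
  by (simp add: hamiltonian_eq exp_minus)

lemma rhs_theta_eq:
  "rhs_theta \<alpha> \<gamma> \<theta> W = - (b * (W * exp (- \<theta>)) / sep (W * exp (- \<theta>)) ^ 3) * (exp (- \<theta>))\<^sup>2"
proof -
  have alg: "- (b * (x * e)) / (e * s) ^ 3 = - (b * x / s ^ 3) * (1 / e)\<^sup>2" if "0 < e" for x e s :: real
    using that by (simp add: power_mult_distrib power2_eq_square power3_eq_cube)
  have "W = W * exp (- \<theta>) * exp \<theta>" by (simp add: exp_minus)
  then show ?thesis
    unfolding rhs_theta_def dsq_powr_three_halves b_def[symmetric]
    using alg[of "exp \<theta>" "W * exp (- \<theta>)" "sep (W * exp (- \<theta>))"]
    by (simp add: exp_minus inverse_eq_divide)
qed

lemma rhs_W_eq: "rhs_W \<alpha> \<gamma> \<theta> W = exp (- \<theta>) * f (W * exp (- \<theta>))"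
  unfolding rhs_W_def dsq_powr_three_halves b_def[symmetric] c_def[symmetric] k_def[symmetric]
    f_def exp_double
  by (simp add: exp_minus power_mult_distrib divide_simps)
    (simp add: algebra_simps power2_eq_square power3_eq_cube)

text \<open>The derivatives are automatically continuous, because the right-hand side is continuous
  along a continuous curve in the phase space.\<close>

lemma is_solutionI:
  assumes "0 < T" "\<theta> 0 = \<theta>0" "W 0 = W0"
    and ps: "\<And>t. t \<in> times T \<Longrightarrow> (\<theta> t, W t) \<in> phase_space \<gamma>"
    and th: "\<And>t. t \<in> times T \<Longrightarrow>
      (\<theta> has_real_derivative rhs_theta \<alpha> \<gamma> (\<theta> t) (W t)) (at t within times T)"
    and W: "\<And>t. t \<in> times T \<Longrightarrow>
      (W has_real_derivative rhs_W \<alpha> \<gamma> (\<theta> t) (W t)) (at t within times T)"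
  shows "is_solution \<alpha> \<gamma> \<theta>0 W0 T \<theta> W"
proof -
  have [continuous_intros]: "continuous_on (times T) \<theta>" "continuous_on (times T) W"
    using th W by (auto simp: continuous_on_eq_continuous_within intro: DERIV_continuous)
  have nz: "dsq \<gamma> (\<theta> t) (W t) powr (3/2) \<noteq> 0" "0 < dsq \<gamma> (\<theta> t) (W t)" if "t \<in> times T" for t
    using ps[OF that] by (auto simp: phase_space_def dsq_def add_nonneg_nonneg less_le)
  have [continuous_intros]: "continuous_on (times T) (\<lambda>t. dsq \<gamma> (\<theta> t) (W t))"
    unfolding dsq_def by (intro continuous_intros)
  have [continuous_intros]: "continuous_on (times T) (\<lambda>t. dsq \<gamma> (\<theta> t) (W t) powr (3/2))"
    using nz by (intro continuous_on_powr continuous_intros) auto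
  have "continuous_on (times T) (\<lambda>t. rhs_theta \<alpha> \<gamma> (\<theta> t) (W t))"
    unfolding rhs_theta_def using nz by (intro continuous_intros) auto
  moreover have "continuous_on (times T) (\<lambda>t. rhs_W \<alpha> \<gamma> (\<theta> t) (W t))"
    unfolding rhs_W_def using nz by (intro continuous_intros) auto
  ultimately show ?thesis
    unfolding is_solution_def C1_on_def using assms by blast
qed

section \<open>Conservation laws along solutions\<close>

lemma h_minus_f: "h w = f w + b * w\<^sup>2 / sep w ^ 3" if "0 < sep w"
proof -
  have "b * k\<^sup>2 / sep w ^ 3 + b * w\<^sup>2 / sep w ^ 3 = b * (sep w)\<^sup>2 / sep w ^ 3"
    by (simp add: sep_power2 distrib_left add_divide_distrib)
  also have "\<dots> = b / sep w"
    using that by (simp add: power2_eq_square power3_eq_cube)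
  finally show ?thesis by (simp add: f_def h_def)
qed

text \<open>The product rule gives \<open>f w + b * w^2 / sep w ^ 3\<close> times
  \<open>(exp (- \<theta>))^2\<close>, and \<open>h_minus_f\<close> identifies the first
  factor.\<close>

lemma scaled_deriv:
  assumes "is_solution \<alpha> \<gamma> \<theta>0 W0 T \<theta> W" "t \<in> times T"
  defines "w \<equiv> \<lambda>t. W t * exp (- \<theta> t)"
  shows "(w has_real_derivative (exp (- \<theta> t))\<^sup>2 * h (w t)) (at t within times T)"
proof -
  have s: "0 < sep (w t)" using assms by (simp add: is_solution_def in_phase_space)
  have th: "(\<theta> has_real_derivative - (b * w t / sep (w t) ^ 3) * (exp (- \<theta> t))\<^sup>2) (at t within times T)"
    and W: "(W has_real_derivative exp (- \<theta> t) * f (w t)) (at t within times T)"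
    using assms by (simp_all add: is_solution_def rhs_theta_eq rhs_W_eq)
  show ?thesis
    unfolding w_def
    by (rule derivative_eq_intros th W refl)+
      (use h_minus_f[OF s] in \<open>simp add: w_def algebra_simps power2_eq_square\<close>)
qed

text \<open>Up to the common factor \<open>(exp (- \<theta>))^2\<close>, the derivative of \<theta>
  is the derivative of \<open>h\<close> at \<open>w\<close> and that of \<open>w\<close> is
  \<open>h w\<close>; hence the two terms in the derivative of \<open>exp (- \<theta>) * h w\<close>
  cancel.\<close>

lemma hamiltonian_conserved:
  assumes sol: "is_solution \<alpha> \<gamma> \<theta>0 W0 T \<theta> W" and t: "t \<in> times T"
  shows "hamiltonian \<alpha> \<gamma> (\<theta> t) (W t) = hamiltonian \<alpha> \<gamma> \<theta>0 W0"
proof -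
  let ?w = "\<lambda>t. W t * exp (- \<theta> t)"
  have "((\<lambda>t. exp (- \<theta> t) * h (?w t)) has_real_derivative 0) (at t within times T)"
    if t: "t \<in> times T" for t
  proof -
    have s: "0 < sep (?w t)" using sol t by (simp add: is_solution_def in_phase_space)
    have th: "(\<theta> has_real_derivative - (b * ?w t / sep (?w t) ^ 3) * (exp (- \<theta> t))\<^sup>2)
        (at t within times T)"
      using sol t by (simp add: is_solution_def rhs_theta_eq)
    have hw: "((\<lambda>t. h (?w t)) has_real_derivative
        - (b * ?w t / sep (?w t) ^ 3) * ((exp (- \<theta> t))\<^sup>2 * h (?w t))) (at t within times T)"
      by (rule DERIV_chain2[OF h_deriv[OF s] scaled_deriv[OF sol t]])
    show ?thesis
      by (rule derivative_eq_intros th hw refl)+ (simp add: algebra_simps)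
  qed
  from has_field_derivative_zero_constant[OF convex_times this]
  obtain C where C: "\<And>t. t \<in> times T \<Longrightarrow> exp (- \<theta> t) * h (?w t) = C" by blast
  have "0 \<in> times T" "\<theta> 0 = \<theta>0" "W 0 = W0"
    using sol times_0 by (auto simp: is_solution_def)
  then show ?thesis using C[OF t] C[of 0] by (simp add: hamiltonian_eq)
qed

text \<open>By the chain rule the derivative is \<open>(exp (- \<theta>) * h w)^2\<close>, the
  squared energy. With \<open>0 < k\<close> the primitive is available for either sign of
  \<open>w\<close>.\<close>

lemma G_linear:
  assumes sol: "is_solution \<alpha> \<gamma> \<theta>0 W0 T \<theta> W" and t: "t \<in> times T" and "0 < k"
  shows "G (W t * exp (- \<theta> t)) = G (W0 * exp (- \<theta>0)) + (hamiltonian \<alpha> \<gamma> \<theta>0 W0)\<^sup>2 * t"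
proof -
  let ?w = "\<lambda>t. W t * exp (- \<theta> t)" and ?H = "hamiltonian \<alpha> \<gamma> \<theta>0 W0"
  have "((\<lambda>t. G (?w t) - ?H\<^sup>2 * t) has_real_derivative 0) (at t within times T)"
    if t: "t \<in> times T" for t
  proof -
    have "((\<lambda>t. G (?w t)) has_real_derivative h (?w t) * ((exp (- \<theta> t))\<^sup>2 * h (?w t)))
        (at t within times T)"
      by (rule DERIV_chain2[OF G_deriv scaled_deriv[OF sol t]]) (simp add: \<open>0 < k\<close>)
    moreover have "h (?w t) * ((exp (- \<theta> t))\<^sup>2 * h (?w t)) = ?H\<^sup>2"
      using hamiltonian_conserved[OF sol t] by (simp add: hamiltonian_eq power2_eq_square algebra_simps)
    ultimately have g: "((\<lambda>t. G (?w t)) has_real_derivative ?H\<^sup>2) (at t within times T)"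
      by simp
    show ?thesis by (rule derivative_eq_intros g refl)+ simp
  qed
  from has_field_derivative_zero_constant[OF convex_times this]
  obtain C where C: "\<And>t. t \<in> times T \<Longrightarrow> G (?w t) - ?H\<^sup>2 * t = C" by blast
  have "0 \<in> times T" "\<theta> 0 = \<theta>0" "W 0 = W0"
    using sol times_0 by (auto simp: is_solution_def)
  then show ?thesis using C[OF t] C[of 0] by simp
qed

section \<open>Explicit solutions and their uniqueness\<close>

text \<open>Converse of the conservation laws: a solution is rebuilt from \<open>w\<close> by
  \<open>exp \<theta> = h w / H\<close> and \<open>W = w * exp \<theta>\<close>.\<close>

lemma solution_of_scaled:
  assumes "0 < T" "H \<noteq> 0"
    and pos: "\<And>t. t \<in> times T \<Longrightarrow> 0 < h (w t) / H"
    and sep: "\<And>t. t \<in> times T \<Longrightarrow> 0 < sep (w t)"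
    and der: "\<And>t. t \<in> times T \<Longrightarrow> (w has_real_derivative H\<^sup>2 / h (w t)) (at t within times T)"
  shows "is_solution \<alpha> \<gamma> (ln (h (w 0) / H)) (w 0 * (h (w 0) / H)) T
    (\<lambda>t. ln (h (w t) / H)) (\<lambda>t. w t * (h (w t) / H))"
proof (rule is_solutionI)
  fix t assume t: "t \<in> times T"
  note p = pos[OF t] and s = sep[OF t]
  have hnz: "h (w t) \<noteq> 0" using p by auto
  have e: "exp (- ln (h (w t) / H)) = H / h (w t)"
    using p by (simp add: exp_minus)
  have sc: "w t * (h (w t) / H) * exp (- ln (h (w t) / H)) = w t"
    unfolding e using hnz \<open>H \<noteq> 0\<close> by simp
  show "(ln (h (w t) / H), w t * (h (w t) / H)) \<in> phase_space \<gamma>"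
    using s by (simp only: in_phase_space sc)
  have hw: "((\<lambda>t. h (w t)) has_real_derivative - (b * w t / sep (w t) ^ 3) * (H\<^sup>2 / h (w t)))
      (at t within times T)"
    by (rule DERIV_chain2[OF h_deriv[OF s] der[OF t]])
  show "((\<lambda>t. ln (h (w t) / H)) has_real_derivative
      rhs_theta \<alpha> \<gamma> (ln (h (w t) / H)) (w t * (h (w t) / H))) (at t within times T)"
    unfolding rhs_theta_eq sc unfolding e
    by (rule DERIV_cong[OF DERIV_chain2[OF DERIV_ln[OF p] DERIV_cdivide[OF hw]]])
      (use hnz \<open>H \<noteq> 0\<close> in \<open>simp add: power2_eq_square mult_ac\<close>)
  have "(h (w t) / H) * (H\<^sup>2 / h (w t)) + (- (b * w t / sep (w t) ^ 3) * (H\<^sup>2 / h (w t)) / H) * w t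
      = H / h (w t) * (h (w t) - b * (w t)\<^sup>2 / sep (w t) ^ 3)"
    using hnz \<open>H \<noteq> 0\<close> by (simp add: power2_eq_square right_diff_distrib mult_ac)
  also have "\<dots> = H / h (w t) * f (w t)" by (simp add: h_minus_f[OF s])
  finally have eq: "w t * (- (b * w t / sep (w t) ^ 3) * (H\<^sup>2 / h (w t)) / H)
      + (H\<^sup>2 / h (w t)) * (h (w t) / H) = H / h (w t) * f (w t)"
    by (simp add: mult.commute add.commute)
  show "((\<lambda>t. w t * (h (w t) / H)) has_real_derivative
      rhs_W \<alpha> \<gamma> (ln (h (w t) / H)) (w t * (h (w t) / H))) (at t within times T)"
    unfolding rhs_W_eq sc unfolding e
    by (rule DERIV_cong[OF DERIV_mult'[OF der[OF t] DERIV_cdivide[OF hw]] eq])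
qed (use assms in auto)

text \<open>The affine law of \<open>G\<close> with slope \<open>H^2\<close> determines
  \<open>w\<close>, from which the solution is rebuilt. The continuous \<open>w\<close> reaches
  \<open>w1\<close> at time \<open>T\<close> even if the solution itself ceases to exist
  there.\<close>

lemma flow_solution:
  assumes "open S" "closed_segment w0 w1 - {w1} \<subseteq> S" "inj_on G (insert w1 S)"
    and reg: "\<And>w. w \<in> insert w1 S \<Longrightarrow> 0 < k \<or> 0 < w"
    and pos: "\<And>w. w \<in> S \<Longrightarrow> 0 < h w / H"
    and H: "H = hamiltonian \<alpha> \<gamma> \<theta>0 W0" "H \<noteq> 0" and w0: "w0 = W0 * exp (- \<theta>0)"
    and T: "0 < T" "G w1 = G w0 + H\<^sup>2 * T"
  obtains w where "w 0 = w0" "w T = w1" "continuous_on {0..T} w"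
    "\<And>t. t \<in> {0..<T} \<Longrightarrow> w t \<in> closed_segment w0 w1 - {w1}"
    "is_solution \<alpha> \<gamma> \<theta>0 W0 (ereal T) (\<lambda>t. ln (h (w t) / H)) (\<lambda>t. w t * (h (w t) / H))"
proof -
  obtain w where w: "w 0 = w0" "w T = w1" "continuous_on {0..T} w"
    "\<And>t. t \<in> {0..<T} \<Longrightarrow> w t \<in> closed_segment w0 w1 - {w1}"
    "\<And>t. t \<in> {0..<T} \<Longrightarrow> (w has_real_derivative H\<^sup>2 / h (w t)) (at t)"
  proof (rule inverse_flow[OF assms(1-3), of h "H\<^sup>2" T])
    show "(G has_real_derivative h w) (at w)" if "w \<in> insert w1 S" for w
      using G_deriv reg that by blast
    show "h w \<noteq> 0" if "w \<in> S" for w using pos[OF that] by auto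
  qed (use H T in auto)
  have wS: "w t \<in> S" if "t \<in> {0..<T}" for t using w(4)[OF that] assms(2) by blast
  have "is_solution \<alpha> \<gamma> (ln (h (w 0) / H)) (w 0 * (h (w 0) / H)) (ereal T)
    (\<lambda>t. ln (h (w t) / H)) (\<lambda>t. w t * (h (w t) / H))"
  proof (rule solution_of_scaled)
    show "0 < sep (w t)" if "t \<in> times (ereal T)" for t
      using reg[of "w t"] wS that sep_pos_iff by auto
  qed (use T H w wS pos in \<open>auto simp: has_field_derivative_at_within\<close>)
  moreover have "h (w 0) / H = exp \<theta>0"
    using H by (simp add: w(1) w0 h_eq)
  moreover have "w 0 * exp \<theta>0 = W0"
    by (simp add: w(1) w0 exp_minus)
  ultimately have "is_solution \<alpha> \<gamma> \<theta>0 W0 (ereal T)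
    (\<lambda>t. ln (h (w t) / H)) (\<lambda>t. w t * (h (w t) / H))"
    by simp
  then show thesis using that w by blast
qed

text \<open>Conservation keeps \<open>w\<close> where \<open>h\<close> has the sign of
  \<open>H\<close>. There the value of \<open>G\<close>, known at each time, determines
  \<open>w\<close>, and then \<open>h w = H * exp \<theta>\<close> determines \<theta>.\<close>

lemma solution_unique:
  assumes sol: "is_solution \<alpha> \<gamma> \<theta>0 W0 T1 \<theta>1 W1" "is_solution \<alpha> \<gamma> \<theta>0 W0 T2 \<theta>2 W2"
    and t: "t \<in> times T1" "t \<in> times T2"
    and "0 < k" and H: "H = hamiltonian \<alpha> \<gamma> \<theta>0 W0" "H \<noteq> 0"
    and inj: "inj_on G {w. 0 < H * h w}"
  shows "\<theta>1 t = \<theta>2 t \<and> W1 t = W2 t"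
proof -
  have h: "h (W1 t * exp (- \<theta>1 t)) = H * exp (\<theta>1 t)" "h (W2 t * exp (- \<theta>2 t)) = H * exp (\<theta>2 t)"
    using hamiltonian_conserved[OF sol(1) t(1)] hamiltonian_conserved[OF sol(2) t(2)] H
    by (simp_all add: h_eq)
  have "0 < H * H" using H(2) by (metis not_real_square_gt_zero)
  then have "W1 t * exp (- \<theta>1 t) \<in> {w. 0 < H * h w}" "W2 t * exp (- \<theta>2 t) \<in> {w. 0 < H * h w}"
    by (simp_all add: h flip: mult.assoc)
  moreover have "G (W1 t * exp (- \<theta>1 t)) = G (W2 t * exp (- \<theta>2 t))"
    using G_linear[OF sol(1) t(1) \<open>0 < k\<close>] G_linear[OF sol(2) t(2) \<open>0 < k\<close>] by simp
  ultimately have eq: "W1 t * exp (- \<theta>1 t) = W2 t * exp (- \<theta>2 t)"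
    by (rule inj_onD[OF inj, rotated 1])
  then have "H * exp (\<theta>1 t) = H * exp (\<theta>2 t)" using h by metis
  then have "\<theta>1 t = \<theta>2 t" using H(2) by simp
  then show ?thesis using eq by simp
qed

section \<open>Monotone branches of \<open>G\<close> and the sign of \<open>h\<close>\<close>

text \<open>The factor \<sigma> treats increasing and decreasing branches at once. The sign is
  required only strictly between the end points, so these may be zeros of \<open>h\<close>.\<close>

lemma G_strict:
  assumes "x < y" "0 < k \<or> 0 < x" "\<And>z. x < z \<Longrightarrow> z < y \<Longrightarrow> 0 < \<sigma> * h z"
  shows "\<sigma> * G x < \<sigma> * G y"
proof (rule DERIV_pos_imp_increasing_open[OF \<open>x < y\<close>])
  have der: "((\<lambda>w. \<sigma> * G w) has_real_derivative \<sigma> * h z) (at z)" if "x \<le> z" for z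
    using that assms(2) by (intro DERIV_cmult G_deriv) auto
  show "\<exists>D. ((\<lambda>w. \<sigma> * G w) has_real_derivative D) (at z) \<and> 0 < D" if "x < z" "z < y" for z
    using der[of z] assms(3) that by auto
  show "continuous_on {x..y} (\<lambda>w. \<sigma> * G w)"
    using der by (auto intro!: continuous_at_imp_continuous_on DERIV_isCont)
qed

lemma G_inj:
  assumes "\<And>x. x \<in> A \<Longrightarrow> 0 < k \<or> 0 < x"
    and "\<And>x y z. x \<in> A \<Longrightarrow> y \<in> A \<Longrightarrow> x < z \<Longrightarrow> z < y \<Longrightarrow> 0 < \<sigma> * h z"
  shows "inj_on G A"
proof (rule linorder_inj_onI)
  fix x y assume "x < y" "x \<in> A" "y \<in> A"
  then have "\<sigma> * G x < \<sigma> * G y" using assms by (intro G_strict) blast+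
  then show "G x \<noteq> G y" by auto
qed auto

lemma sep_le_iff: "sep x \<le> sep y \<longleftrightarrow> \<bar>x\<bar> \<le> \<bar>y\<bar>"
  by (simp add: sep_def abs_le_square_iff)

lemma sep_less_iff: "sep x < sep y \<longleftrightarrow> \<bar>x\<bar> < \<bar>y\<bar>"
  using sep_le_iff[of y x] by linarith

lemma h_pos_iff: "0 < sep w \<Longrightarrow> 0 < h w \<longleftrightarrow> sep w < b / c"
  using c_pos by (simp add: h_def field_simps)

lemma h_neg_iff: "0 < sep w \<Longrightarrow> h w < 0 \<longleftrightarrow> b / c < sep w"
  using c_pos by (simp add: h_def field_simps)

text \<open>An extension would make \<open>\<theta>\<close> converge at \<open>T\<close>.\<close>
lemma is_max_solutionI:
  assumes sol: "is_solution \<alpha> \<gamma> \<theta>0 W0 (ereal T) \<theta> W" and lim: "filterlim \<theta> at_bot (at_left T)"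
  shows "is_max_solution \<alpha> \<gamma> \<theta>0 W0 (ereal T) \<theta> W"
  unfolding is_max_solution_def
proof (intro conjI sol notI, elim exE conjE)
  fix T' \<theta>' W'
  assume T': "ereal T < T'" and sol': "is_solution \<alpha> \<gamma> \<theta>0 W0 T' \<theta>' W'"
    and eq: "\<forall>t\<in>times (ereal T). \<theta>' t = \<theta> t \<and> W' t = W t"
  have T: "0 < T" using sol by (simp add: is_solution_def)
  have sub: "{0..T} \<subseteq> times T'" and TT: "T \<in> times T'"
    using T' T by (auto simp: times_def intro: le_less_trans[of "ereal _" "ereal T"])
  have "(\<theta>' \<longlongrightarrow> \<theta>' T) (at T within times T')"
    using sol' TT unfolding is_solution_def
    by (meson DERIV_continuous continuous_within)
  then have "(\<theta>' \<longlongrightarrow> \<theta>' T) (at T within {0..T})"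
    using sub tendsto_within_subset by blast
  then have "(\<theta>' \<longlongrightarrow> \<theta>' T) (at_left T)"
    using T by (simp add: at_within_Icc_at_left)
  moreover have "\<forall>\<^sub>F t in at_left T. \<theta>' t = \<theta> t"
    using eventually_at_left_real[OF T] by eventually_elim (use eq in auto)
  ultimately have "(\<theta> \<longlongrightarrow> \<theta>' T) (at_left T)" by (simp add: tendsto_cong)
  then show False
    using not_tendsto_and_filterlim_at_infinity[OF _ _ filterlim_at_bot_imp_at_infinity[OF lim]]
    by (simp add: trivial_limit_at_left_real)
qed

text \<open>The derivative of \<open>W\<close> is \<open>f\<close> of the scaled variable times a
  positive exponential.\<close>

lemma W_antimono:
  assumes sol: "is_solution \<alpha> \<gamma> \<theta>0 W0 T \<theta> W"
    and f: "\<And>t. t \<in> times T \<Longrightarrow> f (W t * exp (- \<theta> t)) \<le> 0"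
  shows "antimono_on (times T) W"
proof (rule monotone_onI)
  fix s t assume st: "s \<in> times T" "t \<in> times T" "s \<le> t"
  have sub: "{s..t} \<subseteq> times T"
    using convex_times[of T] st by (metis atLeastAtMost_iff closed_segment_eq_real_ivl
        convex_contains_segment)
  have der: "(W has_real_derivative exp (- \<theta> x) * f (W x * exp (- \<theta> x))) (at x within times T)"
    if "x \<in> times T" for x
    using sol that by (simp add: is_solution_def rhs_W_eq)
  show "W t \<le> W s"
  proof (rule DERIV_nonpos_imp_decreasing_open[OF \<open>s \<le> t\<close>])
    fix x assume x: "s < x" "x < t"
    then have "x \<in> interior (times T)"
      using interior_mono[OF sub] by auto
    then have "(W has_real_derivative exp (- \<theta> x) * f (W x * exp (- \<theta> x))) (at x)"
      using der[of x] by (metis at_within_interior interior_subset subsetD)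
    moreover have "exp (- \<theta> x) * f (W x * exp (- \<theta> x)) \<le> 0"
    proof (rule mult_nonneg_nonpos)
      show "f (W x * exp (- \<theta> x)) \<le> 0" using x sub by (intro f) auto
    qed simp
    ultimately show "\<exists>y. (W has_real_derivative y) (at x) \<and> y \<le> 0" by blast
  next
    have "continuous_on (times T) W" by (rule DERIV_continuous_on[OF der])
    then show "continuous_on {s..t} W" using sub continuous_on_subset by blast
  qed
qed

section \<open>Collision solutions, first at zero energy\<close>

lemma collision_solutionI:
  assumes sol: "is_solution \<alpha> \<gamma> \<theta>0 W0 (ereal T) \<theta> W" and "W0 \<noteq> 0"
    and lim: "filterlim \<theta> at_bot (at_left T)" "(W \<longlongrightarrow> 0) (at_left T)"
    and f: "\<And>t. t \<in> {0..<T} \<Longrightarrow> f (W t * exp (- \<theta> t)) \<le> 0"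
  shows "is_collision_solution \<alpha> \<gamma> \<theta>0 W0 T \<theta> W"
proof -
  have "antimono_on {0..<T} W" using W_antimono[OF sol] f by simp
  then show ?thesis
    using is_max_solutionI[OF sol lim(1)] assms by (simp add: is_collision_solution_def)
qed

lemma collision_zero_energy:
  assumes "0 < W0" "hamiltonian \<alpha> \<gamma> \<theta>0 W0 = 0"
  shows "\<exists>T \<theta> W. is_collision_solution \<alpha> \<gamma> \<theta>0 W0 T \<theta> W"
proof -
  define w0 where "w0 = W0 * exp (- \<theta>0)"
  \<comment> \<open>The scaled variable stays at \<open>w0\<close>, so that
    \<open>\<theta>' = - m * (exp (- \<theta>))^2\<close>. Then \<open>E\<close> is
    \<open>exp (2 * \<theta>)\<close>, affine with slope \<open>- 2 * m\<close> and zero at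
    \<open>T\<close>.\<close>
  define m where "m = b * w0 / sep w0 ^ 3"
  define T where "T = exp (2 * \<theta>0) / (2 * m)"
  define E where "E t = exp (2 * \<theta>0) - 2 * m * t" for t
  define \<theta> where "\<theta> t = ln (E t) / 2" for t
  define W where "W t = w0 * exp (\<theta> t)" for t
  have w0: "0 < w0" using assms by (simp add: w0_def)
  then have s: "0 < sep w0" by (simp add: sep_pos_iff)
  have m: "0 < m" using w0 s b_pos by (simp add: m_def)
  then have T: "0 < T" by (simp add: T_def)
  \<comment> \<open>Zero energy means \<open>h w0 = 0\<close>, so \<open>h_minus_f\<close> gives
    \<open>f w0\<close>.\<close>
  have f: "f w0 = - (m * w0)"
    using h_minus_f[OF s] h_eq[of W0 \<theta>0] assms
    by (simp add: w0_def[symmetric] m_def power2_eq_square)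
  have E: "0 < E t" if "t \<in> {0..<T}" for t
    using that m by (simp add: E_def T_def field_simps)
  have e: "(exp (- \<theta> t))\<^sup>2 = 1 / E t" if "t \<in> {0..<T}" for t
  proof -
    have "(exp (- \<theta> t))\<^sup>2 = exp (2 * (- \<theta> t))" by (simp only: exp_double)
    also have "2 * (- \<theta> t) = - ln (E t)" by (simp add: \<theta>_def)
    finally show ?thesis using E[OF that] by (simp add: exp_minus inverse_eq_divide)
  qed
  have Ww: "W t * exp (- \<theta> t) = w0" for t by (simp add: W_def exp_minus)
  have der: "(\<theta> has_real_derivative - m * (exp (- \<theta> t))\<^sup>2) (at t)" if t: "t \<in> {0..<T}" for t
  proof -
    have "(E has_real_derivative - (2 * m)) (at t)"
      unfolding E_def[abs_def] by (auto intro!: derivative_eq_intros)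
    from DERIV_cdivide[OF DERIV_chain2[where f = ln and g = E, OF DERIV_ln[OF E[OF t]] this], of 2]
    show ?thesis
      unfolding e[OF t] unfolding \<theta>_def[abs_def] by (simp add: inverse_eq_divide)
  qed
  have derW: "(W has_real_derivative exp (- \<theta> t) * f w0) (at t)" if t: "t \<in> {0..<T}" for t
  proof -
    have "w0 * (exp (\<theta> t) * (- m * (exp (- \<theta> t))\<^sup>2)) = exp (- \<theta> t) * f w0"
      by (simp add: f exp_minus power2_eq_square)
    with DERIV_cmult[OF DERIV_chain2[where f = exp and g = \<theta>, OF DERIV_exp der[OF t]], of w0]
    show ?thesis unfolding W_def[abs_def] by simp
  qed
  have "\<theta> 0 = \<theta>0" by (simp add: \<theta>_def E_def)
  moreover from this have "W 0 = W0" by (simp add: W_def w0_def exp_minus)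
  ultimately have sol: "is_solution \<alpha> \<gamma> \<theta>0 W0 (ereal T) \<theta> W"
    using T s der[unfolded m_def] derW
    by (intro is_solutionI)
      (simp_all add: in_phase_space rhs_theta_eq rhs_W_eq Ww has_field_derivative_at_within)
  have lim: "filterlim \<theta> at_bot (at_left T)"
  proof -
    have "(E \<longlongrightarrow> E T) (at_left T)"
      unfolding E_def[abs_def] by (intro tendsto_intros)
    moreover have "E T = 0" using m by (simp add: E_def T_def)
    moreover have "\<forall>\<^sub>F t in at_left T. 0 < E t"
      using eventually_at_left_real[OF T] by eventually_elim (use E in auto)
    ultimately have "filterlim E (at_right 0) (at_left T)"
      by (intro tendsto_imp_filterlim_at_right) auto
    then have "filterlim (\<lambda>t. ln (E t)) at_bot (at_left T)"
      using filterlim_compose ln_at_0 by blast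
    then have "filterlim (\<lambda>t. (1/2) * ln (E t)) at_bot (at_left T)"
      by (subst filterlim_tendsto_pos_mult_at_bot_iff) auto
    then show ?thesis by (simp add: \<theta>_def[abs_def])
  qed
  have "(W \<longlongrightarrow> w0 * 0) (at_left T)"
    unfolding W_def[abs_def] by (intro tendsto_intros filterlim_compose[OF exp_at_bot lim])
  then have "is_collision_solution \<alpha> \<gamma> \<theta>0 W0 T \<theta> W"
    using assms(1) m w0 by (intro collision_solutionI sol lim) (auto simp: Ww f)
  then show ?thesis by blast
qed

end

section \<open>Ratios up to the critical one\<close>

text \<open>For \<open>0 < k\<close> the hypothesis says \<open>0 \<le> h 0\<close>, with equality
  at the critical ratio; \<open>k = 0\<close> is included.\<close>

locale collision_range = vortex +
  assumes k_le: "k * c \<le> b"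
begin

text \<open>The nonnegative zero of \<open>h\<close>; it is \<open>0\<close> exactly when
  \<open>k * c = b\<close>.\<close>

definition ws where "ws = sqrt ((b / c)\<^sup>2 - k\<^sup>2)"

lemma sep_ws: "sep ws = b / c"
proof -
  have "k \<le> b / c" using k_le c_pos by (simp add: field_simps)
  then have "k\<^sup>2 \<le> (b / c)\<^sup>2" using k_nonneg by (intro power_mono)
  then show ?thesis using b_pos c_pos by (simp add: sep_def ws_def)
qed

lemma ws_nonneg: "0 \<le> ws"
proof -
  have "k \<le> b / c" using k_le c_pos by (simp add: field_simps)
  then have "k\<^sup>2 \<le> (b / c)\<^sup>2" using k_nonneg by (intro power_mono)
  then show ?thesis by (simp add: ws_def)
qed

lemma sep_ws_pos: "0 < sep ws" using b_pos c_pos by (simp add: sep_ws)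

lemma h_ws: "h ws = 0" using b_pos c_pos by (simp add: h_def sep_ws)

lemma h_pos_ws: "0 < sep w \<Longrightarrow> 0 < h w \<longleftrightarrow> \<bar>w\<bar> < ws"
  using h_pos_iff[of w] sep_less_iff[of w ws] ws_nonneg by (simp add: sep_ws)

lemma h_neg_ws: "0 < sep w \<Longrightarrow> h w < 0 \<longleftrightarrow> ws < \<bar>w\<bar>"
  using h_neg_iff[of w] sep_less_iff[of ws w] ws_nonneg by (simp add: sep_ws)

text \<open>The scaled variable moves from \<open>w0\<close> up to \<open>ws\<close> if
  \<open>0 < H\<close> and down to \<open>ws\<close> if \<open>H < 0\<close>. It arrives in finite
  time, and there \<open>h w / H\<close>, which is \<open>exp \<theta>\<close>, tends to
  \<open>0\<close>.\<close>

lemma collision_nonzero_energy: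
  assumes W0: "0 < W0" and f0: "f (W0 * exp (- \<theta>0)) \<le> 0"
    and H: "H = hamiltonian \<alpha> \<gamma> \<theta>0 W0" "H \<noteq> 0"
  shows "\<exists>T \<theta> W. is_collision_solution \<alpha> \<gamma> \<theta>0 W0 T \<theta> W"
proof -
  define w0 where "w0 = W0 * exp (- \<theta>0)"
  \<comment> \<open>The part of the half-line \<open>0 < w\<close> on which \<open>h\<close> has the
    sign of \<open>H\<close>; positivity keeps \<open>G\<close> differentiable also for
    \<open>k = 0\<close>.\<close>
  define S where "S = (if 0 < H then {0<..<ws} else {ws<..})"
  define T where "T = (G ws - G w0) / H\<^sup>2"
  have w0: "0 < w0" using W0 by (simp add: w0_def)
  have h0: "h w0 = H * exp \<theta>0" using H by (simp add: w0_def h_eq)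
  have sepS: "0 < w" if "w \<in> S" for w
    using that ws_nonneg by (auto simp: S_def split: if_splits)
  \<comment> \<open>If \<open>ws = 0\<close>, then \<open>0 < sep ws\<close> forces
    \<open>0 < k\<close>.\<close>
  have reg: "0 < k \<or> 0 < w" if "w \<in> insert ws S" for w
    using that sep_ws_pos sepS ws_nonneg unfolding sep_pos_iff by force
  have w0S: "w0 \<in> S"
  proof (cases "0 < H")
    case True
    then have "0 < h w0" by (simp add: h0)
    then show ?thesis using True h_pos_ws[of w0] w0 by (simp add: S_def sep_pos_iff)
  next
    case False
    then have "h w0 < 0" using H(2) by (simp add: h0 mult_less_0_iff)
    then show ?thesis using False h_neg_ws[of w0] w0 by (simp add: S_def sep_pos_iff)
  qed
  have hS: "0 < H * h w" if "w \<in> S" for w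
  proof (cases "0 < H")
    case True
    then show ?thesis using that h_pos_ws[of w] sepS[OF that] by (simp add: S_def sep_pos_iff)
  next
    case False
    then have "h w < 0" using that h_neg_ws[of w] sepS[OF that] by (simp add: S_def sep_pos_iff)
    then show ?thesis using False H(2) by (simp add: mult_neg_neg)
  qed
  have between: "z \<in> S" if "x \<in> insert ws S" "y \<in> insert ws S" "x < z" "z < y" for x y z
    using that ws_nonneg by (auto simp: S_def split: if_splits)
  have seg: "closed_segment w0 ws - {ws} \<subseteq> S"
    using w0S w0 by (auto simp: S_def closed_segment_eq_real_ivl split: if_splits)
  \<comment> \<open>For positive energy \<open>G\<close> increases and \<open>w\<close> moves up;
    for negative energy both are reversed.\<close>
  have "G w0 < G ws"
  proof (cases "0 < H")
    case True
    then have "H * G w0 < H * G ws"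
      using w0S w0 hS by (intro G_strict) (auto simp: S_def)
    then show ?thesis using True by simp
  next
    case False
    then have "H * G ws < H * G w0"
      using w0S reg hS by (intro G_strict) (auto simp: S_def)
    then show ?thesis using False by (auto simp: mult_less_cancel_left)
  qed
  then have T: "0 < T" "G ws = G w0 + H\<^sup>2 * T" using H(2) by (simp_all add: T_def)
  have pos: "0 < h w / H" if "w \<in> S" for w
    using hS[OF that] by (simp add: zero_less_divide_iff zero_less_mult_iff conj_commute)
  have openS: "open S" by (simp add: S_def)
  have inj: "inj_on G (insert ws S)"
    using reg by (rule G_inj[where \<sigma> = H]) (use between hS in blast)+
  obtain w where w: "w 0 = w0" "w T = ws" "continuous_on {0..T} w"
    "\<And>t. t \<in> {0..<T} \<Longrightarrow> w t \<in> closed_segment w0 ws - {ws}"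
    "is_solution \<alpha> \<gamma> \<theta>0 W0 (ereal T) (\<lambda>t. ln (h (w t) / H)) (\<lambda>t. w t * (h (w t) / H))"
    using flow_solution[OF openS seg inj reg pos H w0_def T] by blast
  have wS: "w t \<in> S" if "t \<in> {0..<T}" for t using seg w(4)[OF that] by auto
  have "(w \<longlongrightarrow> w T) (at T within {0..T})"
    using w(3) T by (simp add: continuous_on)
  then have "(w \<longlongrightarrow> ws) (at_left T)" using T by (simp add: at_within_Icc_at_left w(2))
  note wlim = this
  have "((\<lambda>t. h (w t)) \<longlongrightarrow> 0) (at_left T)"
    using isCont_tendsto_compose[OF DERIV_isCont[OF h_deriv[OF sep_ws_pos]] wlim] by (simp add: h_ws)
  then have hlim: "((\<lambda>t. h (w t) / H) \<longlongrightarrow> 0) (at_left T)"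
    by (rule tendsto_divide_zero)
  have Wlim: "((\<lambda>t. w t * (h (w t) / H)) \<longlongrightarrow> 0) (at_left T)"
    using tendsto_mult[OF wlim hlim] by simp
  have "\<forall>\<^sub>F t in at_left T. 0 < h (w t) / H"
    using eventually_at_left_real[OF T(1)] by eventually_elim (use wS pos in auto)
  then have "filterlim (\<lambda>t. h (w t) / H) (at_right 0) (at_left T)"
    by (intro tendsto_imp_filterlim_at_right hlim)
  then have lim: "filterlim (\<lambda>t. ln (h (w t) / H)) at_bot (at_left T)"
    using filterlim_compose ln_at_0 by blast
  \<comment> \<open>For positive energy the separation grows, so \<open>f\<close> stays below its
    initial value; for negative energy \<open>f\<close> lies below the negative
    \<open>h\<close>.\<close>
  have "f (w t) \<le> 0" if t: "t \<in> {0..<T}" for t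
  proof (cases "0 < H")
    case True
    have "w0 \<le> w t" using w(4)[OF t] w0S True
      by (auto simp: S_def closed_segment_eq_real_ivl split: if_splits)
    then have "f (w t) \<le> f w0" using w0 by (intro f_antimono) (auto simp: sep_pos_iff sep_le_iff)
    then show ?thesis using f0 by (simp add: w0_def)
  next
    case False
    then have "h (w t) < 0" using hS[OF wS[OF t]] by (simp add: zero_less_mult_iff)
    then show ?thesis using f_less_h[of "w t"] sepS[OF wS[OF t]] by simp
  qed
  moreover have "w t * (h (w t) / H) * exp (- ln (h (w t) / H)) = w t" if "t \<in> {0..<T}" for t
    using pos[OF wS[OF that]] by (auto simp: exp_minus)
  ultimately have "is_collision_solution \<alpha> \<gamma> \<theta>0 W0 T
      (\<lambda>t. ln (h (w t) / H)) (\<lambda>t. w t * (h (w t) / H))"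
    using W0 by (intro collision_solutionI w lim Wlim) auto
  then show ?thesis by blast
qed

text \<open>The explicit solution passes through \<open>W = 0\<close> without breaking down.\<close>
lemma collision_crossing_False:
  assumes col: "is_collision_solution \<alpha> \<gamma> \<theta>0 W0 T \<theta> W" and W0: "W0 < 0"
    and mono: "mono_on {0..<T} W" and "0 < k" and H: "H = hamiltonian \<alpha> \<gamma> \<theta>0 W0" "0 < H"
  shows False
proof -
  define w0 where "w0 = W0 * exp (- \<theta>0)"
  \<comment> \<open>The whole region of positive \<open>h\<close>, on both sides of
    \<open>w = 0\<close>.\<close>
  define S where "S = {- ws<..<ws}"
  define T1 where "T1 = (G ws - G w0) / H\<^sup>2"
  have sep: "0 < sep w" for w using \<open>0 < k\<close> by (simp add: sep_pos_iff)
  have hS: "0 < H * h w \<longleftrightarrow> w \<in> S" for w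
    using h_pos_ws[OF sep, of w] H(2) by (auto simp: S_def zero_less_mult_iff)
  have pos: "0 < h w / H" if "w \<in> S" for w
    using that hS[of w] H(2) by (simp add: zero_less_mult_iff)
  have "h w0 = H * exp \<theta>0" using H by (simp add: w0_def h_eq)
  then have w0S: "w0 \<in> S" using hS[of w0] H(2) by simp
  have "H * G w0 < H * G ws"
    using w0S hS \<open>0 < k\<close> by (intro G_strict) (auto simp: S_def)
  then have T1: "0 < T1" "G ws = G w0 + H\<^sup>2 * T1" using H(2) by (simp_all add: T1_def)
  have seg: "closed_segment w0 ws - {ws} \<subseteq> S" and openS: "open S"
    using w0S by (auto simp: S_def closed_segment_eq_real_ivl split: if_splits)
  have "0 < H * h z" if "x \<in> insert ws S" "y \<in> insert ws S" "x < z" "z < y" for x y z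
    using that by (subst hS) (auto simp: S_def)
  then have inj: "inj_on G (insert ws S)"
    using \<open>0 < k\<close> by (intro G_inj[where \<sigma> = H]) blast+
  have "{w. 0 < H * h w} \<subseteq> insert ws S" using hS by auto
  then have inj': "inj_on G {w. 0 < H * h w}" using inj inj_on_subset by blast
  have reg: "\<And>w. w \<in> insert ws S \<Longrightarrow> 0 < k \<or> 0 < w" and "H \<noteq> 0" using \<open>0 < k\<close> H by auto
  obtain w where w: "w 0 = w0" "w T1 = ws" "continuous_on {0..T1} w"
    "\<And>t. t \<in> {0..<T1} \<Longrightarrow> w t \<in> closed_segment w0 ws - {ws}"
    "is_solution \<alpha> \<gamma> \<theta>0 W0 (ereal T1) (\<lambda>t. ln (h (w t) / H)) (\<lambda>t. w t * (h (w t) / H))"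
    using flow_solution[OF openS seg inj reg pos H(1) \<open>H \<noteq> 0\<close> w0_def T1] by blast
  have max: "is_max_solution \<alpha> \<gamma> \<theta>0 W0 (ereal T) \<theta> W"
    and lim: "(W \<longlongrightarrow> 0) (at_left T)"
    using col by (simp_all add: is_collision_solution_def)
  then have sol: "is_solution \<alpha> \<gamma> \<theta>0 W0 (ereal T) \<theta> W" by (simp add: is_max_solution_def)
  have agree: "ln (h (w t) / H) = \<theta> t \<and> w t * (h (w t) / H) = W t"
    if "t \<in> {0..<T1}" "t \<in> {0..<T}" for t
    using solution_unique[OF w(5) sol _ _ \<open>0 < k\<close> H(1) \<open>H \<noteq> 0\<close> inj'] that by simp
  \<comment> \<open>Otherwise the explicit solution would extend the maximal one.\<close>
  have "T1 \<le> T"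
  proof (rule ccontr)
    assume "\<not> T1 \<le> T"
    then have "ereal T < ereal T1" and "\<forall>t\<in>times (ereal T).
        ln (h (w t) / H) = \<theta> t \<and> w t * (h (w t) / H) = W t"
      using agree by auto
    then show False using max w(5) unfolding is_max_solution_def by blast
  qed
  have Wneg: "W s \<le> 0" if s: "s \<in> {0..<T}" for s
  proof (rule tendsto_lowerbound[OF lim])
    have "s < T" using s by simp
    from eventually_at_left_real[OF this] show "\<forall>\<^sub>F t in at_left T. W s \<le> W t"
      by eventually_elim (use mono s in \<open>auto simp: mono_on_def\<close>)
  qed (simp add: trivial_limit_at_left_real)
  have wneg: "w t \<le> 0" if t: "t \<in> {0..<T1}" for t
  proof -
    have "w t * (h (w t) / H) \<le> 0" using agree[OF t] Wneg[of t] t \<open>T1 \<le> T\<close> by auto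
    moreover have "0 < h (w t) / H" using pos w(4)[OF t] seg by blast
    ultimately show ?thesis by (simp only: mult_le_0_iff) linarith
  qed
  have "(w \<longlongrightarrow> w T1) (at T1 within {0..T1})"
    using w(3) T1 by (simp add: continuous_on)
  then have "(w \<longlongrightarrow> ws) (at_left T1)" using T1 by (simp add: at_within_Icc_at_left w(2))
  moreover have "\<forall>\<^sub>F t in at_left T1. w t \<le> 0"
    using eventually_at_left_real[OF T1(1)] by eventually_elim (use wneg in auto)
  \<comment> \<open>A nonpositive \<open>w\<close> cannot tend to \<open>ws\<close>, which is
    positive because \<open>S\<close> contains \<open>w0\<close>.\<close>
  ultimately have "ws \<le> 0"
    by (intro tendsto_upperbound) (auto simp: trivial_limit_at_left_real)
  then show False using w0S by (auto simp: S_def)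
qed

text \<open>Monotone convergence to \<open>0\<close> forces \<open>W\<close> to decrease if
  \<open>0 < W0\<close> and to increase if \<open>W0 < 0\<close>, which fixes the sign of
  \<open>f\<close> at time \<open>0\<close>. In the second case the energy is positive and the orbit
  would cross \<open>W = 0\<close>.\<close>

lemma collision_iff:
  "(\<exists>T \<theta> W. is_collision_solution \<alpha> \<gamma> \<theta>0 W0 T \<theta> W) \<longleftrightarrow>
    0 < W0 \<and> f (W0 * exp (- \<theta>0)) \<le> 0"
proof (intro iffI; (elim exE)?)
  fix T \<theta> W
  assume col: "is_collision_solution \<alpha> \<gamma> \<theta>0 W0 T \<theta> W"
  then have sol: "is_solution \<alpha> \<gamma> \<theta>0 W0 (ereal T) \<theta> W" and lim: "(W \<longlongrightarrow> 0) (at_left T)"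
    and nz: "W0 \<noteq> 0" and m: "mono_on {0..<T} W \<or> antimono_on {0..<T} W"
    by (simp_all add: is_collision_solution_def is_max_solution_def)
  have T: "0 < T" and W0: "W 0 = W0" "\<theta> 0 = \<theta>0" using sol by (simp_all add: is_solution_def)
  have near: "\<forall>\<^sub>F t in at_left T. t \<in> {0<..<T}" by (rule eventually_at_left_real[OF T])
  have der: "(W has_real_derivative exp (- \<theta>0) * f (W0 * exp (- \<theta>0))) (at 0 within {0..<T})"
    using sol T W0 by (auto simp: is_solution_def rhs_W_eq)
  show "0 < W0 \<and> f (W0 * exp (- \<theta>0)) \<le> 0"
  proof (cases "0 < W0")
    case True
    have "\<not> mono_on {0..<T} W"
    proof
      assume mono: "mono_on {0..<T} W"
      have "W0 \<le> 0"
        by (rule tendsto_lowerbound[OF lim], use near in eventually_elim)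
          (use mono T W0 in \<open>auto simp: mono_on_def trivial_limit_at_left_real\<close>)
      then show False using True by simp
    qed
    then have anti: "antimono_on {0..<T} W" using m by blast
    have "f (W0 * exp (- \<theta>0)) \<le> 0"
    proof (rule ccontr)
      assume "\<not> ?thesis"
      then have "0 < exp (- \<theta>0) * f (W0 * exp (- \<theta>0))" by simp
      from has_real_derivative_pos_inc_right[OF der this]
      obtain d where d: "0 < d" "\<And>s. 0 < s \<Longrightarrow> s \<in> {0..<T} \<Longrightarrow> s < d \<Longrightarrow> W 0 < W s" by auto
      define s where "s = min d T / 2"
      have "0 < s" "s < d" "s \<in> {0..<T}" using T d(1) by (auto simp: s_def min_def)
      moreover from this have "W s \<le> W 0" using anti T by (auto simp: monotone_on_def)
      ultimately show False using d(2)[of s] by simp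
    qed
    then show ?thesis using True by simp
  next
    case False
    then have neg: "W0 < 0" using nz by simp
    have "\<not> antimono_on {0..<T} W"
    proof
      assume anti: "antimono_on {0..<T} W"
      have "0 \<le> W0"
        by (rule tendsto_upperbound[OF lim], use near in eventually_elim)
          (use anti T W0 in \<open>auto simp: monotone_on_def trivial_limit_at_left_real\<close>)
      then show False using neg by simp
    qed
    then have mono: "mono_on {0..<T} W" using m by blast
    have f0: "0 \<le> f (W0 * exp (- \<theta>0))"
    proof (rule ccontr)
      assume "\<not> ?thesis"
      then have "exp (- \<theta>0) * f (W0 * exp (- \<theta>0)) < 0" by (simp add: mult_pos_neg)
      from has_real_derivative_neg_dec_right[OF der this]
      obtain d where d: "0 < d" "\<And>s. 0 < s \<Longrightarrow> s \<in> {0..<T} \<Longrightarrow> s < d \<Longrightarrow> W s < W 0" by auto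
      define s where "s = min d T / 2"
      have "0 < s" "s < d" "s \<in> {0..<T}" using T d(1) by (auto simp: s_def min_def)
      moreover from this have "W 0 \<le> W s" using mono T by (auto simp: mono_on_def)
      ultimately show False using d(2)[of s] by simp
    qed
    \<comment> \<open>For \<open>k = 0\<close> the function \<open>f\<close> is the negative
      constant \<open>- c\<close>.\<close>
    have "k \<noteq> 0"
    proof
      assume "k = 0"
      then have "f (W0 * exp (- \<theta>0)) < 0" using c_pos by (simp add: f_def)
      then show False using f0 by simp
    qed
    then have "0 < k" using k_nonneg by simp
    moreover have "0 < h (W0 * exp (- \<theta>0))"
      using f0 f_less_h[of "W0 * exp (- \<theta>0)"] nz by simp
    then have "0 < hamiltonian \<alpha> \<gamma> \<theta>0 W0" by (simp add: hamiltonian_eq)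
    ultimately show ?thesis using collision_crossing_False[OF col neg mono] by blast
  qed
next
  assume "0 < W0 \<and> f (W0 * exp (- \<theta>0)) \<le> 0"
  then show "\<exists>T \<theta> W. is_collision_solution \<alpha> \<gamma> \<theta>0 W0 T \<theta> W"
    using collision_zero_energy collision_nonzero_energy by blast
qed

lemma f_nonpos_if_hamiltonian_nonpos:
  assumes "W0 \<noteq> 0" "hamiltonian \<alpha> \<gamma> \<theta>0 W0 \<le> 0"
  shows "f (W0 * exp (- \<theta>0)) \<le> 0"
proof -
  have "h (W0 * exp (- \<theta>0)) \<le> 0" using assms(2) by (simp add: hamiltonian_eq mult_le_0_iff)
  then show ?thesis using f_less_h[of "W0 * exp (- \<theta>0)"] assms(1) by simp
qed

text \<open>Both \<open>f\<close> and \<open>h\<close> decrease with \<open>sep\<close>, and \<open>f\<close> vanishes at \<open>sep = s\<close>. So \<open>f \<le> 0\<close> amounts to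
  \<open>h \<le> hc\<close>, which at energy \<open>H\<close> reads \<open>e\<^sup>\<theta> \<le> hc / H\<close>.\<close>
lemma threshold_exists:
  assumes "0 < k" "k * c < b"
  shows "\<exists>\<theta>s. \<forall>\<theta>0 W0. 0 < W0 \<longrightarrow> 0 < hamiltonian \<alpha> \<gamma> \<theta>0 W0 \<longrightarrow>
    (f (W0 * exp (- \<theta>0)) \<le> 0 \<longleftrightarrow> \<theta>0 \<le> \<theta>s (hamiltonian \<alpha> \<gamma> \<theta>0 W0))"
proof -
  define s where "s = root 3 (b * k\<^sup>2 / c)"
  have s: "0 < s" "s ^ 3 = b * k\<^sup>2 / c" using assms b_pos c_pos by (simp_all add: s_def)
  \<comment> \<open>The value of \<open>h\<close> at separation \<open>s\<close>.\<close>
  define hc where "hc = - c + b / s"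
  \<comment> \<open>Leads to \<open>s < b / c\<close>, which makes \<open>hc\<close> positive and
    its logarithm below meaningful.\<close>
  have "k < b / c" using assms c_pos by (simp add: field_simps)
  then have "k\<^sup>2 < (b / c)\<^sup>2" using k_nonneg by (intro power_strict_mono) auto
  then have "b / c * k\<^sup>2 < b / c * (b / c)\<^sup>2"
    using b_pos c_pos by (intro mult_strict_left_mono) auto
  then have "s ^ 3 < (b / c) ^ 3" unfolding s(2) by (simp add: power2_eq_square power3_eq_cube)
  then have "s < b / c" by (rule power_less_imp_less_base) (use b_pos c_pos in simp)
  then have hc: "0 < hc" using s c_pos by (simp add: hc_def field_simps)
  have "f (W0 * exp (- \<theta>0)) \<le> 0 \<longleftrightarrow> \<theta>0 \<le> ln (hc / H)"
    if W0: "0 < W0" and H: "H = hamiltonian \<alpha> \<gamma> \<theta>0 W0" "0 < H" for \<theta>0 W0 H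
  proof -
    let ?s = "sep (W0 * exp (- \<theta>0))"
    have sp: "0 < ?s" using W0 by (simp add: sep_pos_iff)
    have "f (W0 * exp (- \<theta>0)) \<le> 0 \<longleftrightarrow> s ^ 3 \<le> ?s ^ 3"
      using sp c_pos unfolding s(2) f_def by (simp add: field_simps)
    also have "\<dots> \<longleftrightarrow> s \<le> ?s" using s(1) sp by (simp add: power_mono_iff)
    also have "\<dots> \<longleftrightarrow> h (W0 * exp (- \<theta>0)) \<le> hc"
      using s sp b_pos by (simp add: h_def hc_def field_simps)
    also have "\<dots> \<longleftrightarrow> exp \<theta>0 \<le> hc / H"
      using H by (simp add: h_eq field_simps)
    also have "\<dots> \<longleftrightarrow> \<theta>0 \<le> ln (hc / H)"
      using hc H(2) by (simp add: ln_ge_iff)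
    finally show ?thesis .
  qed
  then show ?thesis by (intro exI[of _ "\<lambda>H. ln (hc / H)"]) blast
qed

end

section \<open>Ratios above the critical one\<close>

text \<open>The hypothesis forces \<open>0 < k\<close> and says \<open>h 0 < 0\<close>. Since
  \<open>h\<close> is largest at \<open>0\<close>, it is negative everywhere.\<close>

locale dispersing = vortex +
  assumes k_gt: "b < k * c"
begin

lemma k_pos: "0 < k"
  using k_gt b_pos k_nonneg by (cases "k = 0") auto

lemma h0_neg: "h 0 < 0"
  using k_gt k_pos by (simp add: h_def sep_def field_simps)

lemma h_le_h0: "h w \<le> h 0"
proof -
  have "b / sep w \<le> b / sep 0"
    using k_pos b_pos by (intro divide_left_mono) (auto simp: sep_le_iff sep_pos_iff)
  then show ?thesis by (simp add: h_def)
qed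

lemma h_neg: "h w < 0"
  using h_le_h0[of w] h0_neg by simp

text \<open>A uniform negative bound, from which the linear decay of \<open>W\<close> is
  derived.\<close>

lemma f_le_h0: "f w \<le> h 0"
proof -
  have "f w \<le> f 0" using k_pos by (intro f_antimono) (auto simp: sep_le_iff sep_pos_iff)
  also have "\<dots> \<le> h 0" using k_pos by (intro f_le_h) (simp add: sep_pos_iff)
  finally show ?thesis .
qed

lemma hamiltonian_neg: "hamiltonian \<alpha> \<gamma> \<theta>0 W0 < 0"
  using h_neg by (simp add: hamiltonian_eq mult_pos_neg)

text \<open>The slope of \<open>G\<close> is at most \<open>h 0 < 0\<close>, so to the left of
  \<open>w0\<close> the graph lies above a line that rises without bound.\<close>

lemma G_surj_below:
  assumes "G w0 \<le> y"
  shows "\<exists>w. G w = y"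
proof -
  \<comment> \<open>The line of slope \<open>h 0\<close> through the point of the graph over
    \<open>w0\<close> has height \<open>y\<close> at \<open>x\<close>.\<close>
  define x where "x = w0 - (y - G w0) / (- h 0)"
  have "x \<le> w0" using assms h0_neg by (simp add: x_def divide_nonneg_nonpos)
  have der: "(G has_real_derivative h z) (at z)" for z using G_deriv k_pos by blast
  have cont: "continuous_on A G" for A
    using der by (meson DERIV_isCont continuous_at_imp_continuous_on)
  have "G w0 - h 0 * w0 \<le> G x - h 0 * x"
  proof (rule DERIV_nonpos_imp_decreasing_open[OF \<open>x \<le> w0\<close>])
    fix z
    have "((\<lambda>w. G w - h 0 * w) has_real_derivative h z - h 0) (at z)"
      by (rule derivative_eq_intros der refl)+ simp
    then show "\<exists>D. ((\<lambda>w. G w - h 0 * w) has_real_derivative D) (at z) \<and> D \<le> 0"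
      using h_le_h0[of z] by auto
  qed (intro continuous_intros cont)
  moreover have "h 0 * x = h 0 * w0 + (y - G w0)"
    using h0_neg by (simp add: x_def distrib_left)
  ultimately have "y \<le> G x" by simp
  then obtain w where "G w = y"
    using IVT2'[of G w0 y x] assms \<open>x \<le> w0\<close> cont by blast
  then show ?thesis by blast
qed

text \<open>If the maximal time were a finite \<open>r\<close>, the explicit solution on
  \<open>{0..<r + 1}\<close> would extend the given one by uniqueness.\<close>

lemma max_solution_global:
  assumes max: "is_max_solution \<alpha> \<gamma> \<theta>0 W0 T \<theta> W"
  shows "T = \<infinity>"
proof (rule ccontr)
  assume "T \<noteq> \<infinity>"
  have sol: "is_solution \<alpha> \<gamma> \<theta>0 W0 T \<theta> W" and "0 < T"
    using max by (simp_all add: is_max_solution_def is_solution_def)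
  with \<open>T \<noteq> \<infinity>\<close> obtain r where r: "T = ereal r" "0 < r" by (cases T) auto
  define H where "H = hamiltonian \<alpha> \<gamma> \<theta>0 W0"
  have H: "H < 0" by (simp add: H_def hamiltonian_neg)
  define w0 where "w0 = W0 * exp (- \<theta>0)"
  have "G w0 \<le> G w0 + H\<^sup>2 * (r + 1)" using r by simp
  then obtain w1 where w1: "G w1 = G w0 + H\<^sup>2 * (r + 1)" using G_surj_below by blast
  have pos: "0 < h w / H" for w using h_neg[of w] H by (simp add: divide_neg_neg)
  have inj: "inj_on G A" for A
    using k_pos h_neg by (intro G_inj[where \<sigma> = "-1"]) auto
  obtain w where w:
    "is_solution \<alpha> \<gamma> \<theta>0 W0 (ereal (r + 1)) (\<lambda>t. ln (h (w t) / H)) (\<lambda>t. w t * (h (w t) / H))"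
    using flow_solution[OF open_UNIV subset_UNIV inj _ pos H_def _ w0_def _ w1] k_pos H r
    by (metis add_pos_pos less_irrefl zero_less_one)
  have "\<forall>t\<in>times T. ln (h (w t) / H) = \<theta> t \<and> w t * (h (w t) / H) = W t"
    using solution_unique[OF w sol _ _ k_pos H_def _ inj] H r by auto
  moreover have "T < ereal (r + 1)" using r by simp
  ultimately show False using max w unfolding is_max_solution_def by blast
qed

text \<open>Conservation and \<open>- c \<le> h\<close> bound \<open>exp (- \<theta>)\<close> below
  by \<open>- H / c\<close>; with \<open>f \<le> h 0\<close> the derivative of \<open>W\<close> is
  at most a negative constant.\<close>

lemma max_solution_dispersing:
  assumes max: "is_max_solution \<alpha> \<gamma> \<theta>0 W0 T \<theta> W"
  shows "T = \<infinity> \<and> C1_on {0<..} \<theta> \<and> C1_on {0<..} W \<and>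
          antimono_on {0..} W \<and> filterlim W at_bot at_top"
proof -
  have T: "T = \<infinity>" by (rule max_solution_global[OF max])
  have sol: "is_solution \<alpha> \<gamma> \<theta>0 W0 \<infinity> \<theta> W"
    using max by (simp add: is_max_solution_def T)
  have C1: "C1_on {0<..} u" if "C1_on {0..} u" for u
  proof -
    have sub: "{0<..} \<subseteq> {0::real..}" by auto
    show ?thesis using that DERIV_subset[OF _ sub] continuous_on_subset[OF _ sub] sub
      unfolding C1_on_def by (meson subsetD)
  qed
  have C: "C1_on {0<..} \<theta>" "C1_on {0<..} W" using sol C1 by (simp_all add: is_solution_def)
  have fneg: "f w \<le> 0" for w using f_le_h0[of w] h0_neg by simp
  have anti: "antimono_on {0..} W" using W_antimono[OF sol] fneg by simp
  define H where "H = hamiltonian \<alpha> \<gamma> \<theta>0 W0"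
  have H: "H < 0" by (simp add: H_def hamiltonian_neg)
  \<comment> \<open>Product of the two bounds \<open>- H / c\<close> and
    \<open>- h 0\<close>.\<close>
  define \<delta> where "\<delta> = H / c * h 0"
  have \<delta>: "0 < \<delta>" using H c_pos h0_neg by (simp add: \<delta>_def divide_neg_pos mult_neg_neg)
  have lin: "W t \<le> W0 - \<delta> * t" if "0 \<le> t" for t
  proof -
    have der: "(W has_real_derivative exp (- \<theta> x) * f (W x * exp (- \<theta> x))) (at x within {0..})"
      if "0 \<le> x" for x
      using sol that by (simp add: is_solution_def rhs_W_eq)
    have bound: "exp (- \<theta> x) * f (W x * exp (- \<theta> x)) \<le> - \<delta>" if "0 \<le> x" for x
    proof -
      have "h (W x * exp (- \<theta> x)) = H * exp (\<theta> x)"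
        using hamiltonian_conserved[OF sol, of x] that by (simp add: h_eq H_def)
      moreover have "- c \<le> h (W x * exp (- \<theta> x))"
        using b_pos sep_nonneg by (simp add: h_def)
      ultimately have "- H / c \<le> exp (- \<theta> x)"
        using c_pos by (simp add: exp_minus field_simps)
      then have "exp (- \<theta> x) * h 0 \<le> (- H / c) * h 0"
        using h0_neg by (intro mult_right_mono_neg) auto
      moreover have "exp (- \<theta> x) * f (W x * exp (- \<theta> x)) \<le> exp (- \<theta> x) * h 0"
        using f_le_h0 by (intro mult_left_mono) auto
      ultimately have "exp (- \<theta> x) * f (W x * exp (- \<theta> x)) \<le> (- H / c) * h 0"
        by (rule order_trans[rotated])
      then show ?thesis by (simp add: \<delta>_def)
    qed
    have "W t + \<delta> * t \<le> W 0 + \<delta> * 0"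
    proof (rule DERIV_nonpos_imp_decreasing_open[OF that])
      fix x assume x: "0 < x" "x < t"
      then have "(W has_real_derivative exp (- \<theta> x) * f (W x * exp (- \<theta> x))) (at x)"
        using der[of x] at_within_interior[of x "{0..}"] by simp
      then have "((\<lambda>t. W t + \<delta> * t) has_real_derivative
          exp (- \<theta> x) * f (W x * exp (- \<theta> x)) + \<delta>) (at x)"
        by (auto intro!: derivative_eq_intros)
      then show "\<exists>D. ((\<lambda>t. W t + \<delta> * t) has_real_derivative D) (at x) \<and> D \<le> 0"
        using bound[of x] x by force
    next
      have "continuous_on {0..} W" using der by (intro DERIV_continuous_on) auto
      then have "continuous_on {0..t} W" by (rule continuous_on_subset) auto
      then show "continuous_on {0..t} (\<lambda>t. W t + \<delta> * t)" by (intro continuous_intros)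
    qed
    then show ?thesis using sol by (simp add: is_solution_def)
  qed
  have "filterlim W at_bot at_top"
    unfolding filterlim_at_bot
  proof
    fix Z
    show "\<forall>\<^sub>F t in at_top. W t \<le> Z"
      using eventually_ge_at_top[of "max 0 ((W0 - Z) / \<delta>)"]
    proof eventually_elim
      case (elim t)
      then have "W0 - Z \<le> \<delta> * t" using \<delta> by (simp add: field_simps)
      then show ?case using lin[of t] elim by simp
    qed
  qed
  then show ?thesis using T C anti by simp
qed

end

section \<open>The critical ratio\<close>

lemma (in vortex) phase_space_eq_UNIV: "phase_space \<gamma> = UNIV" if "0 < k"
  using that by (auto simp: in_phase_space sep_pos_iff)

text \<open>At \<open>a = sqrt \<gamma>\<close> this is \<open>k c / a\<close>, so \<open>h 0\<close> has the sign of \<open>\<alpha> - critical_ratio a\<close>.\<close>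
definition critical_ratio :: "real \<Rightarrow> real" where
  "critical_ratio a = (a - 1) * (a + 1 / a\<^sup>2)"

lemma critical_ratio_strict_mono:
  assumes "1 \<le> a" "a < b"
  shows "critical_ratio a < critical_ratio b"
proof -
  have ab: "1 < a * b" using assms by (metis less_1_mult mult_1 order_le_less less_le_trans)
  \<comment> \<open>With \<open>b - a\<close> factored out, the cofactor is positive because
    \<open>a + b - 1\<close> exceeds \<open>1\<close> and \<open>1 / (a * b)\<close> does
    not.\<close>
  have "critical_ratio b - critical_ratio a =
      (b - a) * ((a + b - 1 - 1 / (a * b)) + (a + b) / (a * b)\<^sup>2)"
    using assms by (simp add: critical_ratio_def field_simps power2_eq_square)
  moreover have "1 / (a * b) < 1" using ab by simp
  then have "0 < (a + b - 1 - 1 / (a * b)) + (a + b) / (a * b)\<^sup>2"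
    using assms by (intro add_pos_nonneg, linarith) auto
  ultimately have "0 < critical_ratio b - critical_ratio a" using assms by simp
  then show ?thesis by simp
qed

lemma critical_ratio_attained:
  assumes "0 < \<alpha>" "\<alpha> < 1"
  shows "\<exists>a>1. critical_ratio a = \<alpha>"
proof -
  have "continuous_on {1..2} critical_ratio"
    unfolding critical_ratio_def[abs_def] by (intro continuous_intros) auto
  \<comment> \<open>The values at \<open>1\<close> and \<open>2\<close> enclose \<alpha>.\<close>
  moreover have e: "critical_ratio 1 = 0" "critical_ratio 2 = 9/4"
    by (simp_all add: critical_ratio_def power2_eq_square)
  ultimately obtain a where a: "1 \<le> a" "critical_ratio a = \<alpha>"
    using IVT'[of critical_ratio 1 \<alpha> 2] assms by auto
  then show ?thesis using e assms by (intro exI[of _ a]) (auto simp: order_less_le)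
qed

lemma (in vortex) critical_ratio_eq: "critical_ratio (sqrt \<gamma>) * sqrt \<gamma> = k * c"
  using gamma_ge by (simp add: critical_ratio_def k_def c_def field_simps power2_eq_square)

theorem theorem2p2:
  fixes \<alpha> :: real
  assumes "0 < \<alpha>" and "\<alpha> < 1"
  shows "\<exists>!\<gamma>s::real. 1 < \<gamma>s \<and>
    (phase_space 1 = UNIV - UNIV \<times> {0} \<and>
     (\<forall>(\<theta>0, W0) \<in> UNIV - UNIV \<times> {0}.
        head_on_collision \<alpha> \<theta>0 W0 \<longleftrightarrow> W0 > 0)) \<and>
    (\<forall>\<gamma>. 1 < \<gamma> \<and> \<gamma> < \<gamma>s \<longrightarrow>
       phase_space \<gamma> = UNIV \<and>
       (\<exists>\<theta>s::real \<Rightarrow> real. \<forall>\<theta>0 W0.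
          asymmetric_collision \<alpha> \<gamma> \<theta>0 W0 \<longleftrightarrow>
          W0 > 0 \<and>
          (hamiltonian \<alpha> \<gamma> \<theta>0 W0 \<le> 0 \<or>
           (hamiltonian \<alpha> \<gamma> \<theta>0 W0 > 0 \<and> \<theta>0 \<le> \<theta>s (hamiltonian \<alpha> \<gamma> \<theta>0 W0))))) \<and>
    (phase_space \<gamma>s = UNIV \<and>
     (\<forall>\<theta>0 W0. asymmetric_collision \<alpha> \<gamma>s \<theta>0 W0 \<longleftrightarrow> W0 > 0)) \<and>
    (\<forall>\<gamma>. \<gamma>s < \<gamma> \<longrightarrow>
       phase_space \<gamma> = UNIV \<and>
       (\<forall>\<theta>0 W0. \<not> asymmetric_collision \<alpha> \<gamma> \<theta>0 W0) \<and>
       (\<forall>\<theta>0 W0 T \<theta> W. is_max_solution \<alpha> \<gamma> \<theta>0 W0 T \<theta> W \<longrightarrow>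
          T = \<infinity> \<and> C1_on {0<..} \<theta> \<and> C1_on {0<..} W \<and>
          antimono_on {0..} W \<and> filterlim W at_bot at_top))"
  (is "\<exists>!\<gamma>s. ?P \<gamma>s")
proof (rule ex_ex1I)
  obtain a where a: "1 < a" "critical_ratio a = \<alpha>" using critical_ratio_attained assms by blast
  \<comment> \<open>The critical \<gamma>: \<open>critical_ratio\<close> takes
    \<open>sqrt \<gamma>\<close> as its argument.\<close>
  define g where "g = a\<^sup>2"
  have sg: "sqrt g = a" and g1: "1 < g" using a by (simp_all add: g_def)
  have vortex: "vortex \<alpha> \<gamma>" if "1 \<le> \<gamma>" for \<gamma> using assms that by unfold_locales
  have k: "0 < vortex.k \<gamma>" if "1 < \<gamma>" for \<gamma>
    using that by (simp add: vortex.k_def[OF vortex])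
  have UN: "phase_space \<gamma> = UNIV" if "1 < \<gamma>" for \<gamma>
    using vortex.phase_space_eq_UNIV[OF vortex k] that by simp
  have ratio: "vortex.k \<gamma> * vortex.c \<gamma> < vortex.b \<alpha> \<gamma> \<longleftrightarrow> critical_ratio (sqrt \<gamma>) < \<alpha>"
    "vortex.b \<alpha> \<gamma> < vortex.k \<gamma> * vortex.c \<gamma> \<longleftrightarrow> \<alpha> < critical_ratio (sqrt \<gamma>)"
    if "1 \<le> \<gamma>" for \<gamma>
    using that vortex.critical_ratio_eq[OF vortex[OF that]]
    by (simp_all add: vortex.b_def[OF vortex[OF that]] flip: vortex.critical_ratio_eq[OF vortex[OF that]])
  have below: "vortex.k \<gamma> * vortex.c \<gamma> < vortex.b \<alpha> \<gamma>" if "1 \<le> \<gamma>" "\<gamma> < g" for \<gamma>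
    using ratio(1)[OF that(1)] critical_ratio_strict_mono[of "sqrt \<gamma>" a] that a sg
    by (metis real_sqrt_ge_1_iff real_sqrt_less_mono)
  have at: "\<not> vortex.b \<alpha> g < vortex.k g * vortex.c g"
    using ratio(2)[of g] g1 a sg by simp
  have above: "vortex.b \<alpha> \<gamma> < vortex.k \<gamma> * vortex.c \<gamma>" if "g < \<gamma>" for \<gamma>
    using ratio(2)[of \<gamma>] critical_ratio_strict_mono[of a "sqrt \<gamma>"] that a sg g1
    by (metis less_imp_le less_trans real_sqrt_less_mono)
  have range: "collision_range \<alpha> \<gamma>" if "1 \<le> \<gamma>" "\<gamma> \<le> g" for \<gamma>
    using vortex[OF that(1)] below[of \<gamma>] at that
    by (cases "\<gamma> = g") (auto simp: collision_range_def collision_range_axioms_def)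
  show "\<exists>\<gamma>s. ?P \<gamma>s"
  proof (intro exI[of _ g] conjI allI impI)
    interpret collision_range \<alpha> 1 using range g1 by simp
    have k0: "k = 0" by (simp add: k_def)
    show "phase_space 1 = UNIV - UNIV \<times> {0}"
      by (auto simp: in_phase_space sep_pos_iff k0)
    \<comment> \<open>For \<open>k = 0\<close> the function \<open>f\<close> is the constant
      \<open>- c\<close>, so \<open>collision_iff\<close> reduces to \<open>0 < W0\<close>.\<close>
    have "f w \<le> 0" for w using c_pos by (simp add: f_def k0)
    then show "\<forall>(\<theta>0, W0) \<in> UNIV - UNIV \<times> {0}. head_on_collision \<alpha> \<theta>0 W0 \<longleftrightarrow> W0 > 0"
      by (simp add: head_on_collision_def collision_iff)
  next
    fix \<gamma> assume \<gamma>: "1 < \<gamma> \<and> \<gamma> < g"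
    then interpret collision_range \<alpha> \<gamma> using range by simp
    \<comment> \<open>The condition \<open>f \<le> 0\<close> of \<open>collision_iff\<close> is
      automatic for nonpositive energy and becomes the threshold for positive energy.\<close>
    obtain \<theta>s where "\<forall>\<theta>0 W0. 0 < W0 \<longrightarrow> 0 < hamiltonian \<alpha> \<gamma> \<theta>0 W0 \<longrightarrow>
        (f (W0 * exp (- \<theta>0)) \<le> 0 \<longleftrightarrow> \<theta>0 \<le> \<theta>s (hamiltonian \<alpha> \<gamma> \<theta>0 W0))"
      using threshold_exists k below \<gamma> by auto
    then show "\<exists>\<theta>s::real \<Rightarrow> real. \<forall>\<theta>0 W0.
          asymmetric_collision \<alpha> \<gamma> \<theta>0 W0 \<longleftrightarrow>
          W0 > 0 \<and>
          (hamiltonian \<alpha> \<gamma> \<theta>0 W0 \<le> 0 \<or>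
           (hamiltonian \<alpha> \<gamma> \<theta>0 W0 > 0 \<and> \<theta>0 \<le> \<theta>s (hamiltonian \<alpha> \<gamma> \<theta>0 W0)))"
      unfolding asymmetric_collision_def collision_iff
      using \<gamma> f_nonpos_if_hamiltonian_nonpos by (metis less_irrefl not_le)
  next
    fix \<theta>0 W0
    interpret collision_range \<alpha> g using range g1 by simp
    \<comment> \<open>Now \<open>b / c\<close> equals \<open>k\<close>, the least separation, so
      \<open>h\<close> is nowhere positive for \<open>0 < W0\<close>.\<close>
    have "k * c = b" using ratio[of g] g1 a sg by simp
    then have "hamiltonian \<alpha> g \<theta>0 W0 \<le> 0" if "0 < W0"
    proof -
      have "b / c \<le> sep (W0 * exp (- \<theta>0))"
        using k_le_sep[of "W0 * exp (- \<theta>0)"] c_pos by (simp flip: \<open>k * c = b\<close>)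
      then show ?thesis
        using h_pos_iff[of "W0 * exp (- \<theta>0)"] that
        by (auto simp: hamiltonian_eq sep_pos_iff mult_le_0_iff not_less)
    qed
    then show "asymmetric_collision \<alpha> g \<theta>0 W0 \<longleftrightarrow> W0 > 0"
      using g1 f_nonpos_if_hamiltonian_nonpos[of W0 \<theta>0]
      by (auto simp: asymmetric_collision_def collision_iff)
  next
    fix \<gamma> \<theta>0 W0 assume \<gamma>: "g < \<gamma>"
    then interpret dispersing \<alpha> \<gamma>
      using vortex above g1 by (simp add: dispersing_def dispersing_axioms_def)
    \<comment> \<open>A collision needs a finite maximal time.\<close>
    show "\<not> asymmetric_collision \<alpha> \<gamma> \<theta>0 W0"
      using max_solution_global by (force simp: asymmetric_collision_def is_collision_solution_def)
    fix T \<theta> W assume "is_max_solution \<alpha> \<gamma> \<theta>0 W0 T \<theta> W"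
    note * = max_solution_dispersing[OF this]
    show "T = \<infinity>" "C1_on {0<..} \<theta>" "C1_on {0<..} W"
      "antimono_on {0..} W" "filterlim W at_bot at_top"
      using * by blast+
  qed (use g1 UN in auto)
next
  \<comment> \<open>If \<open>x < y\<close>, the data \<open>(0, 1)\<close> at ratio
    \<open>y\<close> collide by the critical case for \<open>y\<close> but not by the supercritical
    case for \<open>x\<close>.\<close>
  have less: "\<not> x < y" if P: "?P x" "?P y" for x y
  proof
    assume "x < y"
    then have "\<not> asymmetric_collision \<alpha> y 0 1" using P(1) by blast
    moreover have "asymmetric_collision \<alpha> y 0 1" using P(2) by (metis zero_less_one)
    ultimately show False by blast
  qed
  show "x = y" if "?P x" "?P y" for x y
    using less[OF that] less[OF that(2,1)] by linarith
qed

end
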